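(* Let $\mathcal F$ be an arbitrary set and let $\{\mathbb H_N'\}_{N\ge1}$ be a sequence of mappings from the underlying probability space into $l^\infty(\mathcal F)$ such that each $\mathbb H_N'$ depends on the sample point only through $\mathbf Y_N,\mathbf X_N,\mathbf S_N$ and such that $\mathbb H_N'f$ is measurable for every $N$ and every $f\in\mathcal F$. Assume: (CAT) for every $\eta>0$ there is a compact set $K\subset l^\infty(\mathcal F)$ such that for every $\delta>0$ there is a sequence of random variables $\widetilde A_N\to0$ in probability (almost surely) with $P_d\{\mathbb H_N'\in K^\delta\}+\widetilde A_N\ge1-\eta$ for every $N=1,2,\dots$; (CWCM) for some stochastic process $\{\mathbb H'f:f\in\mathcal F\}$, for every $r=1,2,\dots$, every $\mathbf f=(f_1,\dots,f_r)^\intercal\in\mathcal F^r$ and every $\mathbf t\in\mathbb R^r$, $$E_d\exp(i\mathbf t^\intercal\mathbb H_N'\mathbf f)\to E\exp(i\mathbf t^\intercal\mathbb H'\mathbf f)\quad\text{in probability (almost surely)},$$ where $\mathbb H_N'\mathbf f:=(\mathbb H_N'f_1,\dots,\mathbb H_N'f_r)^\intercal$ and $\mathbb H'\mathbf f:=(\mathbb H'f_1,\dots,\mathbb H'f_r)^\intercal$. Then there exists a version of the stochastic process $\mathbb H'$ which is a Borel measurable and tight mapping from some probability space into $l^\infty(\mathcal F)$ such that $$\sup_{h\in BL_1(l^\infty(\mathcal F))}|E_dh(\mathbb H_N')-Eh(\mathbb H')|\to0\quad\text{in outer probability (outer almost surely)}.$$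
   Context: Probability framework. $(\mathcal Y,\mathcal A)$ and $(\mathcal X,\mathcal B)$ are measurable spaces. The underlying probability space is $\prod_{i=1}^\infty(\Omega_{y,x},\mathcal A_{y,x},P_{y,x})\times(\Omega_d,\mathcal A_d,P_d)$ with product measure $P$. The pairs $(Y_i,X_i)$, $i\ge1$, are the coordinate projections on the first infinitely many coordinates; they are i.i.d. with values in $\mathcal Y\times\mathcal X$. Put $\mathbf Y_N=(Y_1,\dots,Y_N)$, $\mathbf X_N=(X_1,\dots,X_N)$. $D$ is a uniform-$[0,1]$ random variable depending only on the last coordinate. A sampling design gives, for each $N$, selection probabilities $\mathfrak p_N(\mathbf s;\mathbf X_N)\ge0$, $\mathbf s\in\{0,1\}^N$, summing to $1$; designs are assumed measurable, i.e. $\mathbf X_N\mapsto\mathfrak p_N(\mathbf s;\mathbf X_N)$ is measurable for each $\mathbf s$. Enumerating $\{0,1\}^N$ as $\mathbf s^{(1)},\dots,\mathbf s^{(2^N)}$, the vector of inclusion indicators $\mathbf S_N$ equals $\mathbf s^{(1)}$ if $D\le\mathfrak p_N(\mathbf s^{(1)};\mathbf X_N)$, and $\mathbf s^{(i)}$ if $\sum_{j<i}\mathfrak p_N(\mathbf s^{(j)};\mathbf X_N)<D\le\sum_{j\le i}\mathfrak p_N(\mathbf s^{(j)};\mathbf X_N)$. For any (not necessarily measurable) function $g$, $E_dg(\mathbf S_N,\mathbf Y_N,\mathbf X_N):=\sum_{\mathbf s}g(\mathbf s,\mathbf Y_N,\mathbf X_N)\mathfrak p_N(\mathbf s;\mathbf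 X_N)$, a (possibly nonmeasurable) function of $(\mathbf Y_N,\mathbf X_N)$; $P_d$ of an event determined by $(\mathbf S_N,\mathbf Y_N,\mathbf X_N)$ is $E_d$ of its indicator. $l^\infty(\mathcal F)$ is the space of bounded real functions on $\mathcal F$ with norm $\|z\|_{\mathcal F}=\sup_{f\in\mathcal F}|z(f)|$. $BL_1(l^\infty(\mathcal F))$ is the set of $h:l^\infty(\mathcal F)\to[0,1]$ with $|h(z_1)-h(z_2)|\le\|z_1-z_2\|_{\mathcal F}$ for all $z_1,z_2$. $K^\delta:=\{z\in l^\infty(\mathcal F):\|z-z'\|_{\mathcal F}<\delta\text{ for some }z'\in K\}$. A version of a process is a process with the same finite-dimensional distributions. The theorem has two versions: hypotheses in probability give the conclusion in outer probability; hypotheses almost surely give the conclusion outer almost surely. *)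

theory Defs
  imports "HOL-Probability.Probability"
begin

section \<open>The space of bounded functions\<close>

text \<open>Elements of \<open>linf F\<close> are the bounded functions on \<open>F\<close>, normalised to be
  \<^const>\<open>undefined\<close> outside \<open>F\<close>; the metric is the supremum distance over \<open>F\<close>
  (and \<open>0\<close> if \<open>F\<close> is empty).\<close>

abbreviation linf :: "'f set \<Rightarrow> ('f \<Rightarrow> real) metric" where
  "linf F \<equiv> funspace F euclidean_metric"

definition borel_linf :: "'f set \<Rightarrow> ('f \<Rightarrow> real) measure" where
  "borel_linf F = sigma (mspace (linf F)) {U. openin (mtopology_of (linf F)) U}"

definition enlargement :: "'f set \<Rightarrow> ('f \<Rightarrow> real) set \<Rightarrow> real \<Rightarrow> ('f \<Rightarrow> real) set" where
  "enlargement F K \<delta> = {z \<in> mspace (linf F). \<exists>z'\<in>K. mdist (linf F) z z' < \<delta>}"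

text \<open>Members of \<open>BL1 F\<close> are constrained only on the carrier of \<open>linf F\<close>.\<close>

definition BL1 :: "'f set \<Rightarrow> (('f \<Rightarrow> real) \<Rightarrow> real) set" where
  "BL1 F = {h. (\<forall>z\<in>mspace (linf F). 0 \<le> h z \<and> h z \<le> 1) \<and>
     (\<forall>z1\<in>mspace (linf F). \<forall>z2\<in>mspace (linf F). \<bar>h z1 - h z2\<bar> \<le> mdist (linf F) z1 z2)}"

section \<open>Stochastic processes\<close>

definition stochastic_process :: "'c measure \<Rightarrow> 'f set \<Rightarrow> ('f \<Rightarrow> 'c \<Rightarrow> real) \<Rightarrow> bool" where
  "stochastic_process M F Z \<longleftrightarrow> prob_space M \<and> (\<forall>f\<in>F. Z f \<in> borel_measurable M)"

definition same_fdd ::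
  "'f set \<Rightarrow> 'a measure \<Rightarrow> ('f \<Rightarrow> 'a \<Rightarrow> real) \<Rightarrow> 'b measure \<Rightarrow> ('f \<Rightarrow> 'b \<Rightarrow> real) \<Rightarrow> bool" where
  "same_fdd F M Z M' Z' \<longleftrightarrow> (\<forall>J. finite J \<and> J \<subseteq> F \<longrightarrow>
     distr M (PiM J (\<lambda>_. borel)) (\<lambda>\<omega>. \<lambda>f\<in>J. Z f \<omega>) =
     distr M' (PiM J (\<lambda>_. borel)) (\<lambda>\<omega>. \<lambda>f\<in>J. Z' f \<omega>))"

definition tight_map :: "'f set \<Rightarrow> 'a measure \<Rightarrow> ('a \<Rightarrow> 'f \<Rightarrow> real) \<Rightarrow> bool" where
  "tight_map F M G \<longleftrightarrow> (\<forall>\<epsilon>>0. \<exists>K. compactin (mtopology_of (linf F)) K \<and>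
     measure M {\<omega> \<in> space M. G \<omega> \<in> K} \<ge> 1 - \<epsilon>)"

section \<open>Modes of convergence\<close>

datatype conv_mode = In_Probability | Almost_Surely

text \<open>For measurable \<open>Z\<close> the outer measure below is the measure itself, so this is convergence
  in probability; for arbitrary \<open>Z\<close> it is convergence in outer probability.\<close>

definition tendsto_outer_prob ::
  "'w measure \<Rightarrow> (nat \<Rightarrow> 'w \<Rightarrow> 'b::metric_space) \<Rightarrow> 'b \<Rightarrow> bool" where
  "tendsto_outer_prob M Z c \<longleftrightarrow> (\<forall>\<epsilon>>0.
     (\<lambda>N. outer_measure_of M {\<omega> \<in> space M. \<epsilon> < dist (Z N \<omega>) c}) \<longlonglongrightarrow> 0)"

text \<open>Outer almost sure convergence: the distances are dominated by measurable variables which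
  converge to \<open>0\<close> almost surely. This is stronger than pointwise convergence off a null set.\<close>

definition tendsto_outer_as ::
  "'w measure \<Rightarrow> (nat \<Rightarrow> 'w \<Rightarrow> 'b::metric_space) \<Rightarrow> 'b \<Rightarrow> bool" where
  "tendsto_outer_as M Z c \<longleftrightarrow> (\<exists>\<Delta> :: nat \<Rightarrow> 'w \<Rightarrow> real.
     (\<forall>N\<ge>1. \<Delta> N \<in> borel_measurable M \<and> (\<forall>\<omega>\<in>space M. dist (Z N \<omega>) c \<le> \<Delta> N \<omega>)) \<and>
     (AE \<omega> in M. (\<lambda>N. \<Delta> N \<omega>) \<longlonglongrightarrow> 0))"

definition tendsto_mode ::
  "conv_mode \<Rightarrow> 'w measure \<Rightarrow> (nat \<Rightarrow> 'w \<Rightarrow> 'b::metric_space) \<Rightarrow> 'b \<Rightarrow> bool" where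
  "tendsto_mode m M Z c = (case m of
     In_Probability \<Rightarrow> tendsto_outer_prob M Z c
   | Almost_Surely \<Rightarrow> (AE \<omega> in M. (\<lambda>N. Z N \<omega>) \<longlonglongrightarrow> c))"

definition tendsto_outer_mode ::
  "conv_mode \<Rightarrow> 'w measure \<Rightarrow> (nat \<Rightarrow> 'w \<Rightarrow> 'b::metric_space) \<Rightarrow> 'b \<Rightarrow> bool" where
  "tendsto_outer_mode m M Z c = (case m of
     In_Probability \<Rightarrow> tendsto_outer_prob M Z c
   | Almost_Surely \<Rightarrow> tendsto_outer_as M Z c)"

section \<open>Sampling designs\<close>

text \<open>Vectors of length \<open>N\<close> are extensional functions on \<open>{1..N}\<close>. A sample point is a pair of
  the sequence of all \<open>(Y\<^sub>i, X\<^sub>i)\<close>, \<open>i \<ge> 1\<close>, and a point of the randomisation space.\<close>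

abbreviation bin_vecs :: "nat \<Rightarrow> (nat \<Rightarrow> nat) set" where
  "bin_vecs N \<equiv> {1..N} \<rightarrow>\<^sub>E {0, 1}"

definition sample_space ::
  "('y \<times> 'x) measure \<Rightarrow> 'd measure \<Rightarrow> ((nat \<Rightarrow> 'y \<times> 'x) \<times> 'd) measure" where
  "sample_space Pyx Pd = PiM {1..} (\<lambda>_. Pyx) \<Otimes>\<^sub>M Pd"

definition Yvec :: "nat \<Rightarrow> (nat \<Rightarrow> 'y \<times> 'x) \<times> 'd \<Rightarrow> nat \<Rightarrow> 'y" where
  "Yvec N \<omega> = (\<lambda>i\<in>{1..N}. fst (fst \<omega> i))"

definition Xvec :: "nat \<Rightarrow> (nat \<Rightarrow> 'y \<times> 'x) \<times> 'd \<Rightarrow> nat \<Rightarrow> 'x" where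
  "Xvec N \<omega> = (\<lambda>i\<in>{1..N}. snd (fst \<omega> i))"

definition sampling_design ::
  "'x measure \<Rightarrow> (nat \<Rightarrow> (nat \<Rightarrow> nat) \<Rightarrow> (nat \<Rightarrow> 'x) \<Rightarrow> real) \<Rightarrow> bool" where
  "sampling_design MX p \<longleftrightarrow> (\<forall>N\<ge>1.
     (\<forall>s\<in>bin_vecs N. p N s \<in> borel_measurable (PiM {1..N} (\<lambda>_. MX))) \<and>
     (\<forall>x\<in>space (PiM {1..N} (\<lambda>_. MX)).
        (\<forall>s\<in>bin_vecs N. 0 \<le> p N s x) \<and> (\<Sum>s\<in>bin_vecs N. p N s x) = 1))"

text \<open>\<open>e N\<close> enumerates the binary vectors of length \<open>N\<close> with indices \<open>1, \<dots>, 2^N\<close>; \<open>u\<close> is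
  the value of the uniform variable. There is no lower bound on \<open>u\<close> for the first vector. If \<open>u\<close>
  exceeds \<open>1\<close>, which has probability zero, the value is unspecified.\<close>

definition select ::
  "(nat \<Rightarrow> (nat \<Rightarrow> nat) \<Rightarrow> (nat \<Rightarrow> 'x) \<Rightarrow> real) \<Rightarrow> (nat \<Rightarrow> nat \<Rightarrow> nat \<Rightarrow> nat) \<Rightarrow>
     nat \<Rightarrow> (nat \<Rightarrow> 'x) \<Rightarrow> real \<Rightarrow> nat \<Rightarrow> nat" where
  "select p e N x u = (THE s. \<exists>i\<in>{1..2 ^ N}. s = e N i \<and>
     (i = 1 \<or> (\<Sum>j\<in>{1..<i}. p N (e N j) x) < u) \<and> u \<le> (\<Sum>j\<in>{1..i}. p N (e N j) x))"

definition Svec ::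
  "(nat \<Rightarrow> (nat \<Rightarrow> nat) \<Rightarrow> (nat \<Rightarrow> 'x) \<Rightarrow> real) \<Rightarrow> (nat \<Rightarrow> nat \<Rightarrow> nat \<Rightarrow> nat) \<Rightarrow> ('d \<Rightarrow> real) \<Rightarrow>
     nat \<Rightarrow> (nat \<Rightarrow> 'y \<times> 'x) \<times> 'd \<Rightarrow> nat \<Rightarrow> nat" where
  "Svec p e D N \<omega> = select p e N (Xvec N \<omega>) (D (snd \<omega>))"

definition E_d ::
  "(nat \<Rightarrow> (nat \<Rightarrow> nat) \<Rightarrow> (nat \<Rightarrow> 'x) \<Rightarrow> real) \<Rightarrow> nat \<Rightarrow>
     ((nat \<Rightarrow> nat) \<Rightarrow> (nat \<Rightarrow> 'y) \<Rightarrow> (nat \<Rightarrow> 'x) \<Rightarrow> 'b::real_vector) \<Rightarrow>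
     (nat \<Rightarrow> 'y \<times> 'x) \<times> 'd \<Rightarrow> 'b" where
  "E_d p N g \<omega> = (\<Sum>s\<in>bin_vecs N. p N s (Xvec N \<omega>) *\<^sub>R g s (Yvec N \<omega>) (Xvec N \<omega>))"

definition P_d ::
  "(nat \<Rightarrow> (nat \<Rightarrow> nat) \<Rightarrow> (nat \<Rightarrow> 'x) \<Rightarrow> real) \<Rightarrow> nat \<Rightarrow>
     ((nat \<Rightarrow> nat) \<Rightarrow> (nat \<Rightarrow> 'y) \<Rightarrow> (nat \<Rightarrow> 'x) \<Rightarrow> bool) \<Rightarrow>
     (nat \<Rightarrow> 'y \<times> 'x) \<times> 'd \<Rightarrow> real" where
  "P_d p N A = E_d p N (\<lambda>s y x. of_bool (A s y x))"

section \<open>The hypotheses on the sequence of processes\<close>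

text \<open>In what follows \<open>\<phi>\<close> represents the processes as functions of the inclusion indicators and
  the data. A vector \<open>s\<close> with positive selection probability is attained by the inclusion
  indicators, so the design expectations do not depend on the choice of \<open>\<phi>\<close>.\<close>

definition CAT ::
  "conv_mode \<Rightarrow> ((nat \<Rightarrow> 'y \<times> 'x) \<times> 'd) measure \<Rightarrow>
     (nat \<Rightarrow> (nat \<Rightarrow> nat) \<Rightarrow> (nat \<Rightarrow> 'x) \<Rightarrow> real) \<Rightarrow> 'f set \<Rightarrow>
     (nat \<Rightarrow> (nat \<Rightarrow> nat) \<Rightarrow> (nat \<Rightarrow> 'y) \<Rightarrow> (nat \<Rightarrow> 'x) \<Rightarrow> 'f \<Rightarrow> real) \<Rightarrow> bool" where
  "CAT m M p F \<phi> \<longleftrightarrow> (\<forall>\<eta>>0. \<exists>K. compactin (mtopology_of (linf F)) K \<and>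
     (\<forall>\<delta>>0. \<exists>A :: nat \<Rightarrow> (nat \<Rightarrow> 'y \<times> 'x) \<times> 'd \<Rightarrow> real.
        (\<forall>N\<ge>1. A N \<in> borel_measurable M) \<and> tendsto_mode m M A 0 \<and>
        (\<forall>N\<ge>1. \<forall>\<omega>\<in>space M.
           P_d p N (\<lambda>s y x. \<phi> N s y x \<in> enlargement F K \<delta>) \<omega> + A N \<omega> \<ge> 1 - \<eta>)))"

definition CWCM ::
  "conv_mode \<Rightarrow> ((nat \<Rightarrow> 'y \<times> 'x) \<times> 'd) measure \<Rightarrow>
     (nat \<Rightarrow> (nat \<Rightarrow> nat) \<Rightarrow> (nat \<Rightarrow> 'x) \<Rightarrow> real) \<Rightarrow> 'f set \<Rightarrow>
     (nat \<Rightarrow> (nat \<Rightarrow> nat) \<Rightarrow> (nat \<Rightarrow> 'y) \<Rightarrow> (nat \<Rightarrow> 'x) \<Rightarrow> 'f \<Rightarrow> real) \<Rightarrow>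
     'c measure \<Rightarrow> ('f \<Rightarrow> 'c \<Rightarrow> real) \<Rightarrow> bool" where
  "CWCM m M p F \<phi> M' H' \<longleftrightarrow>
     (\<forall>r\<ge>1. \<forall>(f :: nat \<Rightarrow> 'f) (t :: nat \<Rightarrow> real). (\<forall>j\<in>{1..r}. f j \<in> F) \<longrightarrow>
        tendsto_mode m M
          (\<lambda>N. E_d p N (\<lambda>s y x. exp (\<i> * complex_of_real (\<Sum>j=1..r. t j * \<phi> N s y x (f j)))))
          (\<integral>\<xi>. exp (\<i> * complex_of_real (\<Sum>j=1..r. t j * H' (f j) \<xi>)) \<partial>M'))"

end

theory Submission
  imports Defs
begin

text \<open>Trigonometric functions \<open>cos (\<Sum> t\<^sub>j z(f\<^sub>j))\<close>, \<open>sin (\<Sum> t\<^sub>j z(f\<^sub>j))\<close> of a path \<open>z\<close> are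
  defined and bounded on all paths, and their design expectations converge by (CWCM). Countably many
  of them map the paths into the Hilbert cube, where by Stone--Weierstrass every continuous function
  is a uniform limit of linear combinations of trigonometric ones. Since the mapping is Lipschitz in
  each coordinate, (CAT) passes to the limit: for every countable \<open>A \<subseteq> F\<close>, with probability at least
  \<open>1 - \<eta>\<close> the process \<open>H'\<close> agrees on \<open>A\<close> with an element of the compact set \<open>K\<close> of (CAT).

  Let \<open>X\<close> be the union of the compact sets belonging to \<open>\<eta> = 1 / (n + 1)\<close>. A countable subset of \<open>F\<close>
  separates the points of \<open>X\<close>, and the unique element of \<open>X\<close> which agrees with \<open>H'\<close> there is the
  desired version; enlarging the separating set by one index shows that it is a version. Finally the
  restrictions of \<open>BL1 F\<close> to \<open>K\<close> are totally bounded, and by Tietze and Stone--Weierstrass each of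
  finitely many representatives is close on \<open>K\<close> to a trigonometric function bounded by \<open>2\<close>
  everywhere. The error off an enlargement of \<open>K\<close> is controlled by (CAT), which gives uniformity.\<close>

text \<open>Two defects of measurability shape the argument. For uncountable \<open>F\<close> an
  event about the whole path of \<open>H'\<close> need not be measurable, and that path need not be
  bounded, so a member of \<open>BL1 F\<close> cannot be evaluated on it; only countably many
  coordinates are handled at once, and points of compact sets are recovered from these. On the
  sampling side, neither \<open>h\<close> of the process nor membership in an enlargement need have
  a measurable design expectation. Such expectations occur therefore only in pointwise inequalities,
  and every variable that has to be measurable is built from design expectations of trigonometric
  functions and from the corrections supplied by (CAT). The approximants are chosen before the
  sample size, so one measurable bound serves all \<open>h\<close> at once, as the outer almost sure
  mode demands.\<close>

declare mspace_funspace [simp del] mdist_funspace [simp del]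

section \<open>Trigonometric functions\<close>

text \<open>A list of coefficient-index pairs, repetitions allowed, so that adding two arguments of
  trigonometric functions is concatenation and no indices have to be merged.\<close>

definition lin_comb :: "(real \<times> 'f) list \<Rightarrow> ('f \<Rightarrow> real) \<Rightarrow> real" where
  "lin_comb xs z = (\<Sum>(t, f)\<leftarrow>xs. t * z f)"

lemma lin_comb_Nil [simp]: "lin_comb [] z = 0"
  by (simp add: lin_comb_def)

lemma lin_comb_Cons [simp]: "lin_comb ((t, f) # xs) z = t * z f + lin_comb xs z"
  by (simp add: lin_comb_def)

lemma lin_comb_append: "lin_comb (xs @ ys) z = lin_comb xs z + lin_comb ys z"
  by (simp add: lin_comb_def)

lemma lin_comb_uminus: "lin_comb (map (\<lambda>(t, f). (- t, f)) xs) z = - lin_comb xs z"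
  by (induction xs) auto

text \<open>The real span of the real and imaginary parts of characters. Products are not
  constructors: facts stable only under linear operations, such as convergence of averages, can then
  be proved by induction, and closure under products is derived.\<close>

inductive_set trig :: "'f set \<Rightarrow> (('f \<Rightarrow> real) \<Rightarrow> real) set" for F where
  cos: "snd ` set xs \<subseteq> F \<Longrightarrow> (\<lambda>z. cos (lin_comb xs z)) \<in> trig F"
| sin: "snd ` set xs \<subseteq> F \<Longrightarrow> (\<lambda>z. sin (lin_comb xs z)) \<in> trig F"
| add: "g \<in> trig F \<Longrightarrow> h \<in> trig F \<Longrightarrow> (\<lambda>z. g z + h z) \<in> trig F"
| scale: "g \<in> trig F \<Longrightarrow> (\<lambda>z. c * g z) \<in> trig F"

lemma trig_const: "(\<lambda>z. c) \<in> trig F"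
  using trig.scale[OF trig.cos[of "[]" F], of c] by simp

lemma trig_diff_cos:
  assumes "snd ` set xs \<subseteq> F" "snd ` set ys \<subseteq> F"
  shows "(\<lambda>z. cos (lin_comb xs z - lin_comb ys z)) \<in> trig F"
    and "(\<lambda>z. sin (lin_comb xs z - lin_comb ys z)) \<in> trig F"
    and "(\<lambda>z. cos (lin_comb xs z + lin_comb ys z)) \<in> trig F"
    and "(\<lambda>z. sin (lin_comb xs z + lin_comb ys z)) \<in> trig F"
proof -
  let ?ys = "map (\<lambda>(t, f). (- t, f)) ys"
  have 1: "snd ` set (xs @ ?ys) \<subseteq> F" "snd ` set (xs @ ys) \<subseteq> F"
    using assms by auto
  show "(\<lambda>z. cos (lin_comb xs z - lin_comb ys z)) \<in> trig F"
    and "(\<lambda>z. sin (lin_comb xs z - lin_comb ys z)) \<in> trig F"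
    and "(\<lambda>z. cos (lin_comb xs z + lin_comb ys z)) \<in> trig F"
    and "(\<lambda>z. sin (lin_comb xs z + lin_comb ys z)) \<in> trig F"
    using trig.cos[OF 1(1)] trig.sin[OF 1(1)] trig.cos[OF 1(2)] trig.sin[OF 1(2)]
    by (simp_all add: lin_comb_append lin_comb_uminus)
qed

text \<open>The product-to-sum formulas turn a product of two generators into half a sum or
  difference of generators; linearity in \<open>h\<close> extends this to the span.\<close>

lemma trig_mult_base:
  assumes "h \<in> trig F" "snd ` set xs \<subseteq> F"
  shows "(\<lambda>z. cos (lin_comb xs z) * h z) \<in> trig F \<and> (\<lambda>z. sin (lin_comb xs z) * h z) \<in> trig F"
  using assms(1)
proof induction
  case (cos ys)
  note d = trig_diff_cos[OF assms(2) cos]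
  show ?case
    using trig.scale[OF trig.add[OF d(1) d(3)], of "1/2"] trig.scale[OF trig.add[OF d(4) d(2)], of "1/2"]
    by (simp add: cos_times_cos sin_times_cos)
next
  case (sin ys)
  note d = trig_diff_cos[OF assms(2) sin]
  show ?case
    using trig.scale[OF trig.add[OF d(4) trig.scale[OF d(2), of "-1"]], of "1/2"]
      trig.scale[OF trig.add[OF d(1) trig.scale[OF d(3), of "-1"]], of "1/2"]
    by (simp add: sin_times_sin cos_times_sin)
next
  case (add g h)
  then show ?case
    using trig.add by (fastforce simp: distrib_left)
next
  case (scale g c)
  show ?case
    using trig.scale[OF conjunct1[OF scale.IH], of c] trig.scale[OF conjunct2[OF scale.IH], of c]
    by (simp add: mult.left_commute)
qed

lemma trig_mult:
  assumes "g \<in> trig F" "h \<in> trig F"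
  shows "(\<lambda>z. g z * h z) \<in> trig F"
  using assms(1)
proof induction
  case (cos xs)
  then show ?case using trig_mult_base[OF assms(2)] by blast
next
  case (sin xs)
  then show ?case using trig_mult_base[OF assms(2)] by blast
next
  case (add g h)
  then show ?case using trig.add by (fastforce simp: distrib_right)
next
  case (scale g c)
  show ?case
    using trig.scale[OF scale.IH, of c] by (simp add: mult.assoc)
qed

lemma trig_bounded:
  assumes "g \<in> trig F"
  shows "\<exists>B. \<forall>z. \<bar>g z\<bar> \<le> B"
  using assms
proof induction
  case (add g h)
  then obtain B B' where "\<bar>g z\<bar> \<le> B" "\<bar>h z\<bar> \<le> B'" for z by blast
  then have "\<bar>g z + h z\<bar> \<le> B + B'" for z
    by (meson abs_triangle_ineq add_mono order_trans)
  then show ?case by blast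
next
  case (scale g c)
  then obtain B where "\<bar>g z\<bar> \<le> B" for z by blast
  then have "\<bar>c * g z\<bar> \<le> \<bar>c\<bar> * B" for z
    by (simp add: abs_mult mult_left_mono)
  then show ?case by blast
qed (use abs_cos_le_one abs_sin_le_one in blast)+

section \<open>Lipschitz estimates for the supremum distance\<close>

lemma linf_coord:
  assumes "z \<in> mspace (linf F)" "z' \<in> mspace (linf F)" "f \<in> F"
  shows "\<bar>z f - z' f\<bar> \<le> mdist (linf F) z z'"
  using funspace_mdist_le[OF assms(1,2), of "mdist (linf F) z z'"] assms(3)
  by (auto simp: dist_real_def)

lemma linf_eqI:
  assumes "z \<in> mspace (linf F)" "z' \<in> mspace (linf F)" "\<And>f. f \<in> F \<Longrightarrow> z f = z' f"
  shows "z = z'"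
  using assms(3) funspace_imp_extensional[OF assms(1)] funspace_imp_extensional[OF assms(2)]
  by (rule extensionalityI[rotated 2])

text \<open>Evaluation at one index is 1-Lipschitz, so the sum of the absolute coefficients serves
  as constant.\<close>

lemma lin_comb_Lipschitz:
  assumes "snd ` set xs \<subseteq> F"
  shows "\<exists>L\<ge>0. \<forall>z\<in>mspace (linf F). \<forall>z'\<in>mspace (linf F).
    \<bar>lin_comb xs z - lin_comb xs z'\<bar> \<le> L * mdist (linf F) z z'"
  using assms
proof (induction xs)
  case Nil
  then show ?case by (auto intro!: exI[of _ 0])
next
  case (Cons a xs)
  obtain t f where a: "a = (t, f)" by force
  obtain L where L: "L \<ge> 0" "\<And>z z'. z \<in> mspace (linf F) \<Longrightarrow> z' \<in> mspace (linf F) \<Longrightarrow>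
     \<bar>lin_comb xs z - lin_comb xs z'\<bar> \<le> L * mdist (linf F) z z'"
    using Cons by (auto)
  have "\<bar>lin_comb (a # xs) z - lin_comb (a # xs) z'\<bar> \<le> (\<bar>t\<bar> + L) * mdist (linf F) z z'"
    if z: "z \<in> mspace (linf F)" "z' \<in> mspace (linf F)" for z z'
  proof -
    have "\<bar>t * (z f - z' f)\<bar> \<le> \<bar>t\<bar> * mdist (linf F) z z'"
      using linf_coord[OF z, of f] Cons.prems a
      by (auto simp: abs_mult intro!: mult_left_mono)
    then show ?thesis
      using L(2)[OF z] by (simp add: a algebra_simps)
  qed
  then show ?case
    using L(1) by (intro exI[of _ "\<bar>t\<bar> + L"]) auto
qed

lemma abs_cos_diff_le: "\<bar>cos x - cos y\<bar> \<le> \<bar>x - y :: real\<bar>"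
  and abs_sin_diff_le: "\<bar>sin x - sin y\<bar> \<le> \<bar>x - y :: real\<bar>"
proof -
  have s: "\<bar>sin ((y - x) / 2)\<bar> \<le> \<bar>x - y\<bar> / 2" "\<bar>sin ((x - y) / 2)\<bar> \<le> \<bar>x - y\<bar> / 2"
    using abs_sin_x_le_abs_x[of "(y - x) / 2"] abs_sin_x_le_abs_x[of "(x - y) / 2"] by auto
  have "\<bar>cos x - cos y\<bar> = 2 * (\<bar>sin ((x + y) / 2)\<bar> * \<bar>sin ((y - x) / 2)\<bar>)"
    by (simp add: cos_diff_cos abs_mult)
  also have "\<dots> \<le> 2 * (1 * (\<bar>x - y\<bar> / 2))"
    by (intro mult_left_mono mult_mono s) auto
  finally show "\<bar>cos x - cos y\<bar> \<le> \<bar>x - y\<bar>" by simp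
  have "\<bar>sin x - sin y\<bar> = 2 * (\<bar>sin ((x - y) / 2)\<bar> * \<bar>cos ((x + y) / 2)\<bar>)"
    by (simp add: sin_diff_sin abs_mult)
  also have "\<dots> \<le> 2 * ((\<bar>x - y\<bar> / 2) * 1)"
    by (intro mult_left_mono mult_mono s) auto
  finally show "\<bar>sin x - sin y\<bar> \<le> \<bar>x - y\<bar>" by simp
qed

lemma trig_Lipschitz:
  assumes "g \<in> trig F"
  shows "\<exists>L\<ge>0. \<forall>z\<in>mspace (linf F). \<forall>z'\<in>mspace (linf F). \<bar>g z - g z'\<bar> \<le> L * mdist (linf F) z z'"
  using assms
proof induction
  case (cos xs)
  then show ?case
    using lin_comb_Lipschitz[OF cos] by (meson abs_cos_diff_le order_trans)
next
  case (sin xs)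
  then show ?case
    using lin_comb_Lipschitz[OF sin] by (meson abs_sin_diff_le order_trans)
next
  case (add g h)
  obtain L L' where L: "L \<ge> 0" "L' \<ge> 0"
    "\<forall>z\<in>mspace (linf F). \<forall>z'\<in>mspace (linf F). \<bar>g z - g z'\<bar> \<le> L * mdist (linf F) z z'"
    "\<forall>z\<in>mspace (linf F). \<forall>z'\<in>mspace (linf F). \<bar>h z - h z'\<bar> \<le> L' * mdist (linf F) z z'"
    using add.IH by blast
  have "\<bar>g z + h z - (g z' + h z')\<bar> \<le> (L + L') * mdist (linf F) z z'"
    if "z \<in> mspace (linf F)" "z' \<in> mspace (linf F)" for z z'
    using L(3,4)[rule_format, OF that] by (simp add: algebra_simps)
  then show ?case using L(1,2) by (intro exI[of _ "L + L'"]) auto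
next
  case (scale g c)
  then obtain L where L: "L \<ge> 0"
    "\<forall>z\<in>mspace (linf F). \<forall>z'\<in>mspace (linf F). \<bar>g z - g z'\<bar> \<le> L * mdist (linf F) z z'"
    by blast
  have "\<bar>c * g z - c * g z'\<bar> \<le> (\<bar>c\<bar> * L) * mdist (linf F) z z'"
    if "z \<in> mspace (linf F)" "z' \<in> mspace (linf F)" for z z'
    using mult_left_mono[OF L(2)[rule_format, OF that], of "\<bar>c\<bar>"]
    by (simp add: abs_mult[symmetric] algebra_simps)
  then show ?case using L(1) by (intro exI[of _ "\<bar>c\<bar> * L"]) auto
qed

section \<open>Uniform approximation on the Hilbert cube\<close>

lemma compact_cube: "compact {w :: nat \<Rightarrow> real. \<forall>k. \<bar>w k\<bar> \<le> 1}"
proof -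
  have "compactin (product_topology (\<lambda>k::nat. euclidean) UNIV) (PiE UNIV (\<lambda>k. {-1..1::real}))"
    by (subst compactin_PiE) auto
  moreover have "PiE UNIV (\<lambda>k. {-1..1::real}) = {w :: nat \<Rightarrow> real. \<forall>k. \<bar>w k\<bar> \<le> 1}"
    by (auto simp: PiE_iff abs_le_iff minus_le_iff)
  ultimately show ?thesis
    by (simp add: euclidean_product_topology)
qed

text \<open>The functions \<open>g k\<close> map the path space into the Hilbert cube, and the continuous functions
  on the cube which pull back to trigonometric ones form an algebra separating points.\<close>

lemma trig_approx:
  fixes G :: "(nat \<Rightarrow> real) \<Rightarrow> real"
  assumes g: "\<And>k. g k \<in> trig F" "\<And>k z. \<bar>g k z\<bar> \<le> 1"
    and G: "continuous_on UNIV G" and "\<epsilon> > 0"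
  shows "\<exists>T\<in>trig F. \<forall>z. \<bar>T z - G (\<lambda>k. g k z)\<bar> < \<epsilon>"
proof -
  let ?S = "{w :: nat \<Rightarrow> real. \<forall>k. \<bar>w k\<bar> \<le> 1}"
  let ?P = "\<lambda>W. continuous_on UNIV W \<and> (\<lambda>z. W (\<lambda>k. g k z)) \<in> trig F"
  have "\<exists>W. ?P W \<and> (\<forall>x\<in>?S. \<bar>G x - W x\<bar> < \<epsilon>)"
  proof (rule Stone_Weierstrass_HOL)
    show "\<exists>W. ?P W \<and> W x \<noteq> W y" if xy: "x \<in> ?S \<and> y \<in> ?S \<and> x \<noteq> y" for x y
    proof -
      obtain k where "x k \<noteq> y k" using xy ext[of x y] by blast
      moreover have "?P (\<lambda>w. w k)"
        by (simp add: g(1) continuous_on_product_coordinates)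
      ultimately show ?thesis by blast
    qed
    show "continuous_on ?S W" if "?P W" for W
      using that by (metis continuous_on_subset subset_UNIV)
    show "continuous_on ?S G"
      by (rule continuous_on_subset[OF G]) simp
    show "?P (\<lambda>x. c)" for c
      by (simp add: trig_const)
    show "?P (\<lambda>x. V x + W x)" if "?P V \<and> ?P W" for V W
      using that by (simp add: trig.add continuous_on_add)
    show "?P (\<lambda>x. V x * W x)" if "?P V \<and> ?P W" for V W
      using that by (simp add: trig_mult continuous_on_mult)
  qed (rule compact_cube \<open>\<epsilon> > 0\<close>)+
  then obtain W where W: "?P W" "\<And>x. x \<in> ?S \<Longrightarrow> \<bar>G x - W x\<bar> < \<epsilon>" by blast
  have "\<bar>W (\<lambda>k. g k z) - G (\<lambda>k. g k z)\<bar> < \<epsilon>" for z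
    using W(2)[of "\<lambda>k. g k z"] g(2) by (simp add: abs_minus_commute)
  then show ?thesis
    using W(1) by (intro bexI[of _ "\<lambda>z. W (\<lambda>k. g k z)"]) auto
qed

text \<open>Cosine and sine determine an argument only modulo 2 pi. At a frequency 1 / (n + 1) with
  n larger than the distance of \<open>a\<close> and \<open>b\<close>, the difference of the
  arguments lies in [-1, 1], which contains no nonzero multiple of 2 pi.\<close>

lemma cos_sin_scaled_eq_imp_eq:
  fixes a b :: real
  assumes "\<And>n::nat. cos (inverse (real (Suc n)) * a) = cos (inverse (real (Suc n)) * b)"
    and "\<And>n::nat. sin (inverse (real (Suc n)) * a) = sin (inverse (real (Suc n)) * b)"
  shows "a = b"
proof -
  obtain n :: nat where n: "\<bar>a - b\<bar> < real n" using reals_Archimedean2 by blast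
  define c where "c = inverse (real (Suc n)) * (a - b)"
  have "cos c = 1"
  proof -
    have "cos c = cos (inverse (real (Suc n)) * a) * cos (inverse (real (Suc n)) * b)
      + sin (inverse (real (Suc n)) * a) * sin (inverse (real (Suc n)) * b)"
      by (simp add: c_def right_diff_distrib cos_diff)
    then show ?thesis using assms by simp
  qed
  moreover have "\<bar>c\<bar> \<le> 1"
    using n by (simp add: c_def abs_mult divide_simps)
  moreover obtain n :: int where n: "c = of_int n * 2 * pi"
    using \<open>cos c = 1\<close> cos_one_2pi_int[of c] by blast
  moreover have "n = 0"
  proof (rule ccontr)
    assume "n \<noteq> 0"
    then have "1 \<le> \<bar>real_of_int n\<bar>" by linarith
    then have "1 * (2 * pi) \<le> \<bar>real_of_int n\<bar> * (2 * pi)"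
      by (intro mult_right_mono) auto
    then have "2 * pi \<le> \<bar>c\<bar>" by (simp add: n abs_mult)
    then show False using \<open>\<bar>c\<bar> \<le> 1\<close> pi_gt3 by linarith
  qed
  ultimately have "c = 0" by simp
  then show ?thesis by (simp add: c_def)
qed

text \<open>Each index of \<open>A\<close> contributes cosines and sines at all frequencies 1 / (n +
  1), which together determine the value there. The equivalence ranges over all real functions, so
  it applies to the paths of \<open>H'\<close>, bounded or not.\<close>

lemma trig_coordinates:
  assumes "countable A" "A \<subseteq> F"
  shows "\<exists>g :: nat \<Rightarrow> ('f \<Rightarrow> real) \<Rightarrow> real. (\<forall>k. g k \<in> trig F) \<and> (\<forall>k z. \<bar>g k z\<bar> \<le> 1) \<and>
    (\<forall>z z'. (\<forall>k. g k z = g k z') \<longleftrightarrow> (\<forall>f\<in>A. z f = z' f))"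
proof -
  define C where "C = (\<lambda>(f, n::nat) z. cos (lin_comb [(inverse (real (Suc n)), f :: 'f)] z))"
  define S where "S = (\<lambda>(f, n::nat) z. sin (lin_comb [(inverse (real (Suc n)), f :: 'f)] z))"
  \<comment> \<open>The constant 1 keeps \<open>W\<close> nonempty when \<open>A\<close> is empty,
    so that \<open>from_nat_into\<close> enumerates exactly \<open>W\<close>.\<close>
  define W where "W = C ` (A \<times> UNIV) \<union> S ` (A \<times> UNIV) \<union> {\<lambda>z. 1}"
  have W: "countable W" "W \<noteq> {}"
    using assms(1) by (auto simp: W_def)
  have rg: "range (from_nat_into W) = W"
    by (rule range_from_nat_into[OF W(2,1)])
  have in_trig: "h \<in> trig F" "\<bar>h z\<bar> \<le> 1" if "h \<in> W" for h z
  proof -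
    have "C (f, n) \<in> trig F" "S (f, n) \<in> trig F" if "f \<in> A" for f n
      using that assms(2) trig.cos[of "[(inverse (real (Suc n)), f)]" F]
        trig.sin[of "[(inverse (real (Suc n)), f)]" F] by (simp_all add: C_def S_def subset_iff)
    then show "h \<in> trig F"
      using that unfolding W_def by (elim UnE imageE) (simp_all add: trig_const mem_Times_iff split_paired_all)
    show "\<bar>h z\<bar> \<le> 1"
      using that unfolding W_def by (elim UnE imageE) (simp_all add: C_def S_def split_paired_all)
  qed
  have eqW: "(\<forall>k. from_nat_into W k z = from_nat_into W k z') \<longleftrightarrow> (\<forall>h\<in>W. h z = h z')" for z z'
    using Set.ball_simps(9)[of "from_nat_into W" UNIV "\<lambda>h. h z = h z'"] unfolding rg by simp
  moreover have "(\<forall>h\<in>W. h z = h z') \<longleftrightarrow> (\<forall>f\<in>A. z f = z' f)" for z z'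
  proof
    assume h: "\<forall>h\<in>W. h z = h z'"
    show "\<forall>f\<in>A. z f = z' f"
    proof
      fix f assume "f \<in> A"
      then have "C (f, n) \<in> W" "S (f, n) \<in> W" for n by (auto simp: W_def)
      then have eq: "C (f, n) z = C (f, n) z'" "S (f, n) z = S (f, n) z'" for n using h by blast+
      show "z f = z' f"
        by (rule cos_sin_scaled_eq_imp_eq) (use eq in \<open>simp_all add: C_def S_def\<close>)
    qed
  next
    assume z: "\<forall>f\<in>A. z f = z' f"
    show "\<forall>h\<in>W. h z = h z'"
      unfolding W_def by (intro ballI, elim UnE imageE) (simp_all add: C_def S_def z split_paired_all)
  qed
  ultimately show ?thesis
    using in_trig[OF from_nat_into[OF W(2)]]
    by (intro exI[of _ "from_nat_into W"] conjI allI) simp_all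
qed

section \<open>Compact sets of bounded functions\<close>

lemma Metric_space_linf: "Metric_space (mspace (linf F)) (mdist (linf F))"
  by (rule Metric_space_mspace_mdist)

lemma compactin_linf_closedin:
  "compactin (mtopology_of (linf F)) K \<Longrightarrow> closedin (mtopology_of (linf F)) K"
  by (rule compactin_imp_closedin)
    (simp_all add: mtopology_of_def Metric_space.Hausdorff_space_mtopology[OF Metric_space_linf])

lemma compactin_linf_subset: "compactin (mtopology_of (linf F)) K \<Longrightarrow> K \<subseteq> mspace (linf F)"
  by (drule compactin_subset_topspace) simp

lemma linf_dist_sym: "mdist (linf F) z z' = mdist (linf F) z' z"
  by (rule Metric_space.commute[OF Metric_space_linf])

lemma linf_dist_nonneg: "0 \<le> mdist (linf F) z z'"
  by (rule Metric_space.nonneg[OF Metric_space_linf])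

lemma linf_dist_triangle:
  assumes "z \<in> mspace (linf F)" "z' \<in> mspace (linf F)" "z'' \<in> mspace (linf F)"
  shows "mdist (linf F) z z'' \<le> mdist (linf F) z z' + mdist (linf F) z' z''"
  by (rule Metric_space.triangle[OF Metric_space_linf assms])

lemma linf_compact_net:
  assumes "compactin (mtopology_of (linf F)) K" "\<epsilon> > 0"
  obtains A where "finite A" "A \<subseteq> K" "\<forall>z\<in>K. \<exists>a\<in>A. mdist (linf F) a z < \<epsilon>"
proof -
  interpret Metric_space "mspace (linf F)" "mdist (linf F)"
    by (rule Metric_space_linf)
  have tb: "mtotally_bounded K"
    using assms(1) unfolding mtopology_of_def by (rule compactin_imp_mtotally_bounded)
  obtain A where A: "finite A" "A \<subseteq> K" "K \<subseteq> (\<Union>x\<in>A. mball x \<epsilon>)"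
    using tb[unfolded mtotally_bounded_def, rule_format, OF assms(2)] by (elim exE conjE)
  have "\<forall>z\<in>K. \<exists>a\<in>A. mdist (linf F) a z < \<epsilon>"
    using A(3) unfolding subset_iff UN_iff in_mball by blast
  with A(1,2) show thesis by (rule that)
qed

text \<open>A supremum exceeding \<open>a\<close> has a term exceeding \<open>a\<close>. For empty
  \<open>F\<close> the distance is 0, which \<open>0 \<le> a\<close> excludes.\<close>

lemma linf_dist_witness:
  assumes "z \<in> mspace (linf F)" "z' \<in> mspace (linf F)" "a < mdist (linf F) z z'" "0 \<le> a"
  shows "\<exists>f\<in>F. a < \<bar>z f - z' f\<bar>"
proof (cases "F = {}")
  case True
  then have "z = z'" by (intro linf_eqI[OF assms(1,2)]) blast
  then have "mdist (linf F) z z' = 0"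
    using Metric_space.zero[OF Metric_space_linf assms(1,2)] by blast
  then show ?thesis using assms(3,4) by linarith
next
  case False
  then show ?thesis
    using funspace_mdist_le[OF assms(1,2) False, of a] assms(3)
    unfolding dist_real_def by (metis mdist_euclidean_metric dist_real_def not_le)
qed

text \<open>Finite nets give a countable dense subset \<open>B\<close> of the union. For each pair
  of distinct members of \<open>B\<close> one index is kept at which they differ by more than half
  their distance; by density these countably many indices separate all points of the union.\<close>

lemma countable_separating_set:
  assumes K: "\<And>m::nat. compactin (mtopology_of (linf F)) (K m)"
  shows "\<exists>A. countable A \<and> A \<subseteq> F \<and>
    (\<forall>z\<in>\<Union>m. K m. \<forall>z'\<in>\<Union>m. K m. (\<forall>f\<in>A. z f = z' f) \<longrightarrow> z = z')"
proof -
  have exN: "\<exists>N. finite N \<and> N \<subseteq> K m \<and> (\<forall>z\<in>K m. \<exists>a\<in>N. mdist (linf F) a z < inverse (real (Suc n)))" for m n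
    by (rule linf_compact_net[OF K[of m], of "inverse (real (Suc n))"]) (simp, intro exI conjI)
  define N where "N m n = (SOME N. finite N \<and> N \<subseteq> K m \<and>
    (\<forall>z\<in>K m. \<exists>a\<in>N. mdist (linf F) a z < inverse (real (Suc n))))" for m n
  have N: "\<And>m n. finite (N m n)" "\<And>m n. N m n \<subseteq> K m"
    "\<And>m n z. z \<in> K m \<Longrightarrow> \<exists>a\<in>N m n. mdist (linf F) a z < inverse (real (Suc n))"
    using someI_ex[OF exN] unfolding N_def by blast+
  define B where "B = (\<Union>m n. N m n)"
  have "countable B"
    unfolding B_def by (intro countable_UN countableI_type countable_finite[OF N(1)])
  have KF: "K m \<subseteq> mspace (linf F)" for m by (rule compactin_linf_subset[OF K])
  have BF: "b \<in> mspace (linf F)" if "b \<in> B" for b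
    using that N(2) KF unfolding B_def by blast
  have near: "\<exists>a\<in>B. mdist (linf F) a z < \<epsilon>" if z: "z \<in> (\<Union>m. K m)" and \<epsilon>: "\<epsilon> > 0" for z \<epsilon>
  proof -
    obtain n where n: "inverse (real (Suc n)) < \<epsilon>" using reals_Archimedean[OF \<epsilon>] by blast
    obtain m where m: "z \<in> K m" using z by blast
    obtain a where "a \<in> N m n" "mdist (linf F) a z < inverse (real (Suc n))"
      using N(3)[OF m] by blast
    moreover from this(1) have "a \<in> B" unfolding B_def by blast
    ultimately show ?thesis using n less_trans by blast
  qed
  have ex: "\<exists>f. f \<in> F \<and> mdist (linf F) a b / 2 < \<bar>a f - b f\<bar>" if "a \<in> B" "b \<in> B" "0 < mdist (linf F) a b" for a b
    using linf_dist_witness[OF BF[OF that(1)] BF[OF that(2)], of "mdist (linf F) a b / 2"] that(3) by auto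
  define w where "w a b = (SOME f. f \<in> F \<and> mdist (linf F) a b / 2 < \<bar>a f - b f\<bar>)" for a b
  have w: "w a b \<in> F" "mdist (linf F) a b / 2 < \<bar>a (w a b) - b (w a b)\<bar>"
    if "a \<in> B" "b \<in> B" "0 < mdist (linf F) a b" for a b
    using someI_ex[OF ex[OF that]] unfolding w_def by blast+
  define A where "A = (\<lambda>(a, b). w a b) ` {(a, b) \<in> B \<times> B. 0 < mdist (linf F) a b}"
  have cA: "countable A"
    unfolding A_def by (rule countable_image, rule countable_subset[of _ "B \<times> B"])
      (use \<open>countable B\<close> in auto)
  have AF: "A \<subseteq> F" unfolding A_def using w(1) by auto
  have sep: "z = z'" if z: "z \<in> (\<Union>m. K m)" "z' \<in> (\<Union>m. K m)" and eq: "\<forall>f\<in>A. z f = z' f" for z z'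
  proof (rule ccontr)
    assume ne: "z \<noteq> z'"
    have zF: "z \<in> mspace (linf F)" "z' \<in> mspace (linf F)" using z KF by blast+
    define d where "d = mdist (linf F) z z'"
    have "d > 0"
      using ne linf_dist_nonneg[of F z z'] Metric_space.zero[OF Metric_space_linf zF]
      unfolding d_def by linarith
    \<comment> \<open>Net points within \<open>d / 8\<close> are still at distance at least
      \<open>3 / 4 * d\<close>, so \<open>a\<close> and \<open>b\<close> differ by more than
      \<open>3 / 8 * d\<close> at the chosen index; agreement of \<open>z\<close> and
      \<open>z'\<close> there would allow less than \<open>d / 4\<close>.\<close>
    obtain a where a: "a \<in> B" "mdist (linf F) a z < d / 8" using near[OF z(1), of "d / 8"] \<open>d > 0\<close> by auto
    obtain b where b: "b \<in> B" "mdist (linf F) b z' < d / 8" using near[OF z(2), of "d / 8"] \<open>d > 0\<close> by auto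
    have "d \<le> mdist (linf F) z a + (mdist (linf F) a b + mdist (linf F) b z')"
      unfolding d_def
      using linf_dist_triangle[OF zF(1) BF[OF a(1)] zF(2)] linf_dist_triangle[OF BF[OF a(1)] BF[OF b(1)] zF(2)]
      by linarith
    then have ab: "3 / 4 * d \<le> mdist (linf F) a b"
      using a(2) b(2) linf_dist_sym[of F z a] by linarith
    then have ab0: "0 < mdist (linf F) a b" using \<open>d > 0\<close> by linarith
    note f = w[OF a(1) b(1) ab0]
    have "w a b \<in> A" unfolding A_def using a(1) b(1) ab0 by force
    then have "z (w a b) = z' (w a b)" using eq by blast
    moreover have "\<bar>a (w a b) - z (w a b)\<bar> < d / 8" "\<bar>b (w a b) - z' (w a b)\<bar> < d / 8"
      using linf_coord[OF BF[OF a(1)] zF(1) f(1)] linf_coord[OF BF[OF b(1)] zF(2) f(1)] a(2) b(2)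
      by linarith+
    ultimately show False using f(2) ab \<open>d > 0\<close> by linarith
  qed
  show ?thesis by (intro exI[of _ A] conjI cA AF ballI impI, rule sep)
qed

section \<open>Bounded Lipschitz functions on compact sets\<close>

lemma BL1_bounds: "h \<in> BL1 F \<Longrightarrow> z \<in> mspace (linf F) \<Longrightarrow> 0 \<le> h z \<and> h z \<le> 1"
  unfolding BL1_def by blast

lemma BL1_Lipschitz:
  "h \<in> BL1 F \<Longrightarrow> z \<in> mspace (linf F) \<Longrightarrow> z' \<in> mspace (linf F) \<Longrightarrow> \<bar>h z - h z'\<bar> \<le> mdist (linf F) z z'"
  unfolding BL1_def by blast

text \<open>The members of \<open>BL1 F\<close> are classified by their values, rounded to multiples of \<open>\<epsilon> / 3\<close>, on a
  finite \<open>\<epsilon> / 3\<close>-net of \<open>K\<close>.\<close>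

lemma BL1_finite_net:
  assumes K: "compactin (mtopology_of (linf F)) K" and "\<epsilon> > 0"
  obtains H where "H \<subseteq> BL1 F" "finite H" "\<forall>h\<in>BL1 F. \<exists>h'\<in>H. \<forall>z\<in>K. \<bar>h z - h' z\<bar> \<le> \<epsilon>"
proof -
  define e where "e = \<epsilon> / 3"
  have e: "e > 0" "\<epsilon> = e + e + e" using \<open>\<epsilon> > 0\<close> by (auto simp: e_def)
  obtain A where A: "finite A" "A \<subseteq> K" "\<forall>z\<in>K. \<exists>a\<in>A. mdist (linf F) a z < e"
    using linf_compact_net[OF K e(1)] .
  have KF: "K \<subseteq> mspace (linf F)" by (rule compactin_linf_subset[OF K])
  define q where "q h = (\<lambda>a\<in>A. \<lfloor>h a / e\<rfloor>)" for h :: "('a \<Rightarrow> real) \<Rightarrow> real"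
  have "q ` BL1 F \<subseteq> PiE A (\<lambda>_. {0..\<lfloor>1 / e\<rfloor>})"
  proof (clarify, intro PiE_I)
    fix h a assume "h \<in> BL1 F" "a \<in> A"
    then have "0 \<le> h a / e" "h a / e \<le> 1 / e"
      using BL1_bounds[of h F a] A(2) KF e(1) by (auto simp: divide_right_mono)
    then show "q h a \<in> {0..\<lfloor>1 / e\<rfloor>}"
      using \<open>a \<in> A\<close> by (auto simp: q_def floor_mono)
  qed (auto simp: q_def)
  then have fin: "finite (q ` BL1 F)"
    by (rule finite_subset) (simp add: finite_PiE A(1))
  \<comment> \<open>One representative for each rounding pattern, taken inside \<open>BL1 F\<close>
    so that the Lipschitz bound applies to it as well.\<close>
  define H where "H = inv_into (BL1 F) q ` q ` BL1 F"
  have "\<exists>h'\<in>H. \<forall>z\<in>K. \<bar>h z - h' z\<bar> \<le> \<epsilon>" if h: "h \<in> BL1 F" for h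
  proof (intro bexI ballI)
    define h' where "h' = inv_into (BL1 F) q (q h)"
    have qh: "q h \<in> q ` BL1 F" using h by blast
    have h': "h' \<in> BL1 F" "q h' = q h"
      unfolding h'_def by (rule inv_into_into[OF qh], rule f_inv_into_f[OF qh])
    fix z assume z: "z \<in> K"
    obtain a where a: "a \<in> A" "mdist (linf F) a z < e" using A(3) z by blast
    have "\<lfloor>h a / e\<rfloor> = \<lfloor>h' a / e\<rfloor>"
      using fun_cong[OF h'(2), of a] a(1) by (simp add: q_def)
    then have "\<bar>h a / e - h' a / e\<bar> \<le> 1" by linarith
    then have "\<bar>h a - h' a\<bar> \<le> e"
      using e(1) by (simp add: diff_divide_distrib[symmetric] abs_divide)
    moreover have "z \<in> mspace (linf F)" "a \<in> mspace (linf F)" using z a(1) A(2) KF by auto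
    then have "\<bar>h a - h z\<bar> \<le> e" "\<bar>h' a - h' z\<bar> \<le> e"
      using BL1_Lipschitz[OF h, of a z] BL1_Lipschitz[OF h'(1), of a z] a(2) by auto
    ultimately show "\<bar>h z - inv_into (BL1 F) q (q h) z\<bar> \<le> \<epsilon>"
      unfolding h'_def[symmetric] e(2) by linarith
  qed (use h in \<open>auto simp: H_def\<close>)
  moreover have "H \<subseteq> BL1 F" unfolding H_def by (auto intro: inv_into_into)
  moreover have "finite H" unfolding H_def using fin by simp
  ultimately show thesis using that by blast
qed

lemma continuous_map_linf_Lipschitz:
  assumes "\<And>z z'. z \<in> mspace (linf F) \<Longrightarrow> z' \<in> mspace (linf F) \<Longrightarrow> \<bar>g z - g z'\<bar> \<le> L * mdist (linf F) z z'"
  shows "continuous_map (mtopology_of (linf F)) euclideanreal g"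
  using Lipschitz_continuous_imp_continuous_map[of "linf F" euclidean_metric g] assms
  by (auto simp: Lipschitz_continuous_map_def dist_real_def)

lemma continuous_map_trig: "g \<in> trig F \<Longrightarrow> continuous_map (mtopology_of (linf F)) euclideanreal g"
  using trig_Lipschitz[of g F] continuous_map_linf_Lipschitz[of F g] by blast

lemma continuous_map_BL1: "h \<in> BL1 F \<Longrightarrow> continuous_map (mtopology_of (linf F)) euclideanreal h"
  using BL1_Lipschitz[of h F] by (intro continuous_map_linf_Lipschitz[of F h 1]) auto

lemma compact_trig_image:
  fixes g :: "nat \<Rightarrow> ('f \<Rightarrow> real) \<Rightarrow> real"
  assumes g: "\<And>k. g k \<in> trig F" and K: "compactin (mtopology_of (linf F)) K"
  shows "compact ((\<lambda>z k. g k z) ` K)"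
proof -
  have "continuous_map (mtopology_of (linf F)) euclidean (\<lambda>z k. g k z)"
    unfolding euclidean_product_topology[symmetric] continuous_map_componentwise_UNIV
    using continuous_map_trig[OF g] by simp
  from image_compactin[OF K this] show ?thesis by simp
qed

text \<open>A continuous injection of a compact set into a Hausdorff space is a homeomorphism onto
  its image. Hence \<open>h\<close> becomes a continuous function on a compact set of sequences, and
  its extension keeps the bound 1.\<close>

lemma trig_approx_BL1:
  fixes g :: "nat \<Rightarrow> ('f \<Rightarrow> real) \<Rightarrow> real"
  assumes K: "compactin (mtopology_of (linf F)) K"
    and g: "\<And>k. g k \<in> trig F" "\<And>k z. \<bar>g k z\<bar> \<le> 1" and inj: "inj_on (\<lambda>z k. g k z) K"
    and h: "h \<in> BL1 F" and \<epsilon>: "0 < \<epsilon>" "\<epsilon> \<le> 1"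
  shows "\<exists>T\<in>trig F. (\<forall>z\<in>K. \<bar>T z - h z\<bar> \<le> \<epsilon>) \<and> (\<forall>z. \<bar>T z\<bar> \<le> 2)"
proof -
  define \<iota> where "\<iota> = (\<lambda>z k. g k z)"
  have KF: "K \<subseteq> mspace (linf F)" by (rule compactin_linf_subset[OF K])
  have inv: "inv_into K \<iota> (\<iota> z) = z" if "z \<in> K" for z
    using inv_into_f_f[OF inj that] by (simp add: \<iota>_def)
  have "closed (\<iota> ` K)" unfolding \<iota>_def by (rule compact_imp_closed[OF compact_trig_image[of g, OF g(1) K]])
  \<comment> \<open>Continuity is checked on closed sets: their preimages are the images of compact
    subsets of \<open>K\<close>.\<close>
  have "continuous_on (\<iota> ` K) (\<lambda>w. h (inv_into K \<iota> w))"
    unfolding continuous_on_closed_invariant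
  proof (intro allI impI)
    fix B :: "real set" assume "closed B"
    then have "closedin (mtopology_of (linf F)) {z \<in> mspace (linf F). h z \<in> B}"
      using closedin_continuous_map_preimage[OF continuous_map_BL1[OF h], of B] by simp
    from compact_Int_closedin[OF K this]
    have "compact (\<iota> ` (K \<inter> {z \<in> mspace (linf F). h z \<in> B}))"
      unfolding \<iota>_def by (rule compact_trig_image[of g, OF g(1)])
    moreover have "\<iota> ` (K \<inter> {z \<in> mspace (linf F). h z \<in> B}) \<inter> \<iota> ` K
       = (\<lambda>w. h (inv_into K \<iota> w)) -` B \<inter> \<iota> ` K"
      using inv KF by (auto simp: image_iff) (metis IntI inv)+
    ultimately show "\<exists>A. closed A \<and> A \<inter> \<iota> ` K = (\<lambda>w. h (inv_into K \<iota> w)) -` B \<inter> \<iota> ` K"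
      using compact_imp_closed by blast
  qed
  moreover have "norm (h (inv_into K \<iota> w)) \<le> 1" if "w \<in> \<iota> ` K" for w
    using that inv BL1_bounds[OF h] KF by auto
  ultimately obtain G where G: "continuous_on UNIV G" "\<And>w. w \<in> \<iota> ` K \<Longrightarrow> G w = h (inv_into K \<iota> w)"
    "\<And>w. norm (G w) \<le> 1"
    using Tietze[of "\<iota> ` K" "\<lambda>w. h (inv_into K \<iota> w)" UNIV 1] \<open>closed (\<iota> ` K)\<close> by auto
  obtain T where T: "T \<in> trig F" "\<And>z. \<bar>T z - G (\<lambda>k. g k z)\<bar> < \<epsilon>"
    using trig_approx[of g, OF g G(1) \<epsilon>(1)] by blast
  have "\<bar>T z - h z\<bar> \<le> \<epsilon>" if "z \<in> K" for z
    using T(2)[of z] G(2)[of "\<iota> z"] inv[OF that] that by (simp add: \<iota>_def)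
  \<comment> \<open>The extension is bounded by 1 and the approximation error by \<epsilon> \<le> 1;
    both bounds hold for every path \<open>z\<close>, also an unbounded one.\<close>
  moreover have "\<bar>T z\<bar> \<le> 2" for z
    using T(2)[of z] G(3)[of "\<lambda>k. g k z"] \<epsilon>(2) by (simp add: abs_le_iff) linarith
  ultimately show ?thesis using T(1) by blast
qed

section \<open>Borel sets of the space of bounded functions\<close>

lemma space_borel_linf [simp]: "space (borel_linf F) = mspace (linf F)"
  by (simp add: borel_linf_def space_measure_of_conv)

lemma sets_borel_linf: "sets (borel_linf F) = sigma_sets (mspace (linf F)) {U. openin (mtopology_of (linf F)) U}"
  using openin_subset[of "mtopology_of (linf F)"] by (auto simp: borel_linf_def intro!: sets_measure_of)

lemma closedin_borel_linf:
  assumes "closedin (mtopology_of (linf F)) C"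
  shows "C \<in> sets (borel_linf F)"
proof -
  have "mspace (linf F) - C \<in> sets (borel_linf F)"
    using assms by (auto simp: sets_borel_linf closedin_def)
  then have "mspace (linf F) - (mspace (linf F) - C) \<in> sets (borel_linf F)"
    using sets.compl_sets[of "mspace (linf F) - C" "borel_linf F"] by simp
  then show ?thesis
    using closedin_subset[OF assms] by (simp add: double_diff)
qed

lemma continuous_map_borel_linf_measurable:
  assumes "continuous_map (mtopology_of (linf F)) euclideanreal h"
  shows "h \<in> borel_measurable (borel_linf F)"
proof (rule borel_measurableI)
  fix S :: "real set" assume "open S"
  then show "h -` S \<inter> space (borel_linf F) \<in> sets (borel_linf F)"
    using openin_continuous_map_preimage[OF assms, of S]
    by (auto simp: sets_borel_linf vimage_def Int_def conj_commute intro!: sigma_sets.Basic)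
qed

lemma measurable_borel_linfI:
  assumes "\<And>\<omega>. \<omega> \<in> space M \<Longrightarrow> X \<omega> \<in> mspace (linf F)"
    and "\<And>C. closedin (mtopology_of (linf F)) C \<Longrightarrow> {\<omega> \<in> space M. X \<omega> \<in> C} \<in> sets M"
  shows "X \<in> M \<rightarrow>\<^sub>M borel_linf F"
  unfolding borel_linf_def
proof (rule measurable_measure_of)
  fix U assume "U \<in> {U. openin (mtopology_of (linf F)) U}"
  then have "closedin (mtopology_of (linf F)) (mspace (linf F) - U)"
    using openin_subset by (fastforce simp: closedin_def double_diff)
  from sets.compl_sets[OF assms(2)[OF this]]
  have "space M - {\<omega> \<in> space M. X \<omega> \<in> mspace (linf F) - U} \<in> sets M" .
  moreover have "space M - {\<omega> \<in> space M. X \<omega> \<in> mspace (linf F) - U} = X -` U \<inter> space M"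
    using assms(1) by auto
  ultimately show "X -` U \<inter> space M \<in> sets M" by simp
qed (use assms(1) openin_subset in fastforce)+

section \<open>Modes of convergence\<close>

text \<open>Both sets are replaced by measurable hulls of the same outer measure.\<close>

lemma outer_measure_of_Un:
  assumes "A \<subseteq> space M" "B \<subseteq> space M"
  shows "outer_measure_of M (A \<union> B) \<le> outer_measure_of M A + outer_measure_of M B"
proof -
  obtain E where E: "E \<in> sets M" "A \<subseteq> E" "outer_measure_of M A = emeasure M E"
    using outer_measure_of_attain[OF assms(1)] by blast
  obtain G where G: "G \<in> sets M" "B \<subseteq> G" "outer_measure_of M B = emeasure M G"
    using outer_measure_of_attain[OF assms(2)] by blast
  have "outer_measure_of M (A \<union> B) \<le> outer_measure_of M (E \<union> G)"
    by (rule outer_measure_of_mono[OF Un_mono[OF E(2) G(2)]])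
  also have "\<dots> = emeasure M (E \<union> G)"
    using E(1) G(1) by (intro outer_measure_of_eq sets.Un)
  also have "\<dots> \<le> emeasure M E + emeasure M G"
    by (rule emeasure_subadditive[OF E(1) G(1)])
  finally show ?thesis by (simp add: E(3) G(3))
qed

text \<open>Carries limits through Lipschitz operations such as scaling, absolute values, and real
  and imaginary parts.\<close>

lemma tendsto_mode_dominated:
  assumes V: "tendsto_mode m M V v"
    and le: "\<And>N \<omega>. N \<ge> 1 \<Longrightarrow> \<omega> \<in> space M \<Longrightarrow> dist (Z N \<omega>) c \<le> B * dist (V N \<omega>) v"
  shows "tendsto_mode m M Z c"
proof (cases m)
  case In_Probability
  have "(\<lambda>N. outer_measure_of M {\<omega> \<in> space M. \<epsilon> < dist (Z N \<omega>) c}) \<longlonglongrightarrow> 0" if "\<epsilon> > 0" for \<epsilon>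
  proof (rule tendsto_sandwich[OF _ _ tendsto_const])
    \<comment> \<open>\<open>B\<close> may be zero or negative; \<open>\<bar>B\<bar> + 1\<close> is
      a positive replacement by which one can divide.\<close>
    define e where "e = \<epsilon> / (\<bar>B\<bar> + 1)"
    have "e > 0" using \<open>\<epsilon> > 0\<close> by (simp add: e_def)
    then show "(\<lambda>N. outer_measure_of M {\<omega> \<in> space M. e < dist (V N \<omega>) v}) \<longlonglongrightarrow> 0"
      using V In_Probability by (simp add: tendsto_mode_def tendsto_outer_prob_def)
    have "e < dist (V N \<omega>) v" if "N \<ge> 1" "\<omega> \<in> space M" "\<epsilon> < dist (Z N \<omega>) c" for N \<omega>
    proof -
      have "B * dist (V N \<omega>) v \<le> (\<bar>B\<bar> + 1) * dist (V N \<omega>) v"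
        by (intro mult_right_mono) auto
      then have "\<epsilon> < (\<bar>B\<bar> + 1) * dist (V N \<omega>) v"
        using le[OF that(1,2)] that(3) by linarith
      moreover have "\<bar>B\<bar> + 1 > 0" by simp
      ultimately show ?thesis by (simp only: e_def pos_divide_less_eq mult.commute)
    qed
    then show "\<forall>\<^sub>F N in sequentially. outer_measure_of M {\<omega> \<in> space M. \<epsilon> < dist (Z N \<omega>) c}
        \<le> outer_measure_of M {\<omega> \<in> space M. e < dist (V N \<omega>) v}"
      by (intro eventually_sequentiallyI[of 1] outer_measure_of_mono) auto
  qed simp
  then show ?thesis
    using In_Probability by (simp add: tendsto_mode_def tendsto_outer_prob_def)
next
  case Almost_Surely
  then have "AE \<omega> in M. (\<lambda>N. V N \<omega>) \<longlonglongrightarrow> v"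
    using V by (simp add: tendsto_mode_def)
  then have "AE \<omega> in M. (\<lambda>N. Z N \<omega>) \<longlonglongrightarrow> c"
  proof (rule AE_mp, intro AE_I2 impI)
    fix \<omega> assume \<omega>: "\<omega> \<in> space M" "(\<lambda>N. V N \<omega>) \<longlonglongrightarrow> v"
    have "(\<lambda>N. B * dist (V N \<omega>) v) \<longlonglongrightarrow> B * 0"
      using \<omega>(2) by (intro tendsto_mult tendsto_const) (simp add: tendsto_dist_iff[symmetric])
    moreover have "\<forall>\<^sub>F N in sequentially. norm (dist (Z N \<omega>) c) \<le> B * dist (V N \<omega>) v"
      using le \<omega>(1) by (intro eventually_sequentiallyI[of 1]) simp
    ultimately have "(\<lambda>N. dist (Z N \<omega>) c) \<longlonglongrightarrow> 0"
      using Lim_null_comparison[of "\<lambda>N. dist (Z N \<omega>) c"] by simp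
    then show "(\<lambda>N. Z N \<omega>) \<longlonglongrightarrow> c" by (simp add: tendsto_dist_iff[symmetric])
  qed
  then show ?thesis using Almost_Surely by (simp add: tendsto_mode_def)
qed

lemma tendsto_mode_const: "tendsto_mode m M (\<lambda>N \<omega>. c) c"
  by (cases m) (simp_all add: tendsto_mode_def tendsto_outer_prob_def)

lemma tendsto_mode_add:
  fixes V W :: "nat \<Rightarrow> 'a \<Rightarrow> 'b::real_normed_vector"
  assumes V: "tendsto_mode m M V v" and W: "tendsto_mode m M W w"
  shows "tendsto_mode m M (\<lambda>N \<omega>. V N \<omega> + W N \<omega>) (v + w)"
proof (cases m)
  case In_Probability
  have "(\<lambda>N. outer_measure_of M {\<omega> \<in> space M. \<epsilon> < dist (V N \<omega> + W N \<omega>) (v + w)}) \<longlonglongrightarrow> 0"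
    if "\<epsilon> > 0" for \<epsilon>
  proof (rule tendsto_sandwich[OF _ _ tendsto_const])
    let ?A = "\<lambda>N. {\<omega> \<in> space M. \<epsilon> / 2 < dist (V N \<omega>) v}"
    let ?B = "\<lambda>N. {\<omega> \<in> space M. \<epsilon> / 2 < dist (W N \<omega>) w}"
    have "\<forall>e>0. (\<lambda>N. outer_measure_of M {\<omega> \<in> space M. e < dist (V N \<omega>) v}) \<longlonglongrightarrow> 0"
      "\<forall>e>0. (\<lambda>N. outer_measure_of M {\<omega> \<in> space M. e < dist (W N \<omega>) w}) \<longlonglongrightarrow> 0"
      using V W In_Probability by (simp_all add: tendsto_mode_def tendsto_outer_prob_def)
    then have "(\<lambda>N. outer_measure_of M (?A N) + outer_measure_of M (?B N)) \<longlonglongrightarrow> 0 + 0"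
      using half_gt_zero[OF \<open>\<epsilon> > 0\<close>] by (intro tendsto_add) blast+
    then show "(\<lambda>N. outer_measure_of M (?A N) + outer_measure_of M (?B N)) \<longlonglongrightarrow> 0" by simp
    have "outer_measure_of M {\<omega> \<in> space M. \<epsilon> < dist (V N \<omega> + W N \<omega>) (v + w)}
        \<le> outer_measure_of M (?A N) + outer_measure_of M (?B N)" for N
    proof (rule order_trans[OF outer_measure_of_mono outer_measure_of_Un])
      show "{\<omega> \<in> space M. \<epsilon> < dist (V N \<omega> + W N \<omega>) (v + w)} \<subseteq> ?A N \<union> ?B N"
      proof
        fix \<omega> assume \<omega>: "\<omega> \<in> {\<omega> \<in> space M. \<epsilon> < dist (V N \<omega> + W N \<omega>) (v + w)}"
        then have "\<epsilon> < dist (V N \<omega>) v + dist (W N \<omega>) w"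
          using dist_triangle_add[of "V N \<omega>" "W N \<omega>" v w] by simp
        then have "\<epsilon> / 2 < dist (V N \<omega>) v \<or> \<epsilon> / 2 < dist (W N \<omega>) w" by linarith
        then show "\<omega> \<in> ?A N \<union> ?B N" using \<omega> by auto
      qed
    qed auto
    then show "\<forall>\<^sub>F N in sequentially.
        outer_measure_of M {\<omega> \<in> space M. \<epsilon> < dist (V N \<omega> + W N \<omega>) (v + w)}
        \<le> outer_measure_of M (?A N) + outer_measure_of M (?B N)"
      by (intro always_eventually) simp
  qed simp
  then show ?thesis
    using In_Probability by (simp add: tendsto_mode_def tendsto_outer_prob_def)
next
  case Almost_Surely
  then have "AE \<omega> in M. (\<lambda>N. V N \<omega>) \<longlonglongrightarrow> v" "AE \<omega> in M. (\<lambda>N. W N \<omega>) \<longlonglongrightarrow> w"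
    using V W by (simp_all add: tendsto_mode_def)
  then have "AE \<omega> in M. (\<lambda>N. V N \<omega> + W N \<omega>) \<longlonglongrightarrow> v + w"
  proof eventually_elim
    case (elim \<omega>)
    then show ?case by (rule tendsto_add)
  qed
  then show ?thesis using Almost_Surely by (simp add: tendsto_mode_def)
qed

lemma tendsto_mode_sum:
  fixes V :: "'i \<Rightarrow> nat \<Rightarrow> 'a \<Rightarrow> 'b::real_normed_vector"
  assumes "finite S" "\<And>i. i \<in> S \<Longrightarrow> tendsto_mode m M (V i) 0"
  shows "tendsto_mode m M (\<lambda>N \<omega>. \<Sum>i\<in>S. V i N \<omega>) 0"
  using assms
proof (induction S)
  case empty
  then show ?case using tendsto_mode_const by simp
next
  case (insert i S)
  have "tendsto_mode m M (\<lambda>N \<omega>. V i N \<omega> + (\<Sum>i\<in>S. V i N \<omega>)) (0 + 0)"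
    using insert.prems by (intro tendsto_mode_add insert.IH) auto
  then show ?case using insert.hyps by simp
qed

text \<open>For the almost sure mode the dominating variables at the levels \<open>1 / (n + 1)\<close> are combined
  into one by taking the infimum over \<open>n\<close>.\<close>

lemma tendsto_outer_modeI:
  fixes Z :: "nat \<Rightarrow> 'a \<Rightarrow> 'b::metric_space"
  assumes "\<And>\<epsilon>::real. \<epsilon> > 0 \<Longrightarrow> \<exists>V :: nat \<Rightarrow> 'a \<Rightarrow> real. (\<forall>N\<ge>1. V N \<in> borel_measurable M) \<and>
    tendsto_mode m M V 0 \<and> (\<forall>N\<ge>1. \<forall>\<omega>\<in>space M. dist (Z N \<omega>) c \<le> \<epsilon> + V N \<omega>)"
  shows "tendsto_outer_mode m M Z c"
proof (cases m)
  case In_Probability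
  have "(\<lambda>N. outer_measure_of M {\<omega> \<in> space M. \<epsilon> < dist (Z N \<omega>) c}) \<longlonglongrightarrow> 0" if "\<epsilon> > 0" for \<epsilon>
  proof -
    obtain V where V: "tendsto_mode m M V (0::real)"
      "\<forall>N\<ge>1. \<forall>\<omega>\<in>space M. dist (Z N \<omega>) c \<le> \<epsilon> / 2 + V N \<omega>"
      using assms[of "\<epsilon> / 2"] \<open>\<epsilon> > 0\<close> by auto
    show ?thesis
    proof (rule tendsto_sandwich[OF _ _ tendsto_const])
      show "(\<lambda>N. outer_measure_of M {\<omega> \<in> space M. \<epsilon> / 2 < dist (V N \<omega>) 0}) \<longlonglongrightarrow> 0"
        using V(1) half_gt_zero[OF \<open>\<epsilon> > 0\<close>]
        unfolding tendsto_mode_def tendsto_outer_prob_def In_Probability conv_mode.case by blast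
      have "\<epsilon> / 2 < dist (V N \<omega>) 0" if "N \<ge> 1" "\<omega> \<in> space M" "\<epsilon> < dist (Z N \<omega>) c" for N \<omega>
        using V(2)[rule_format, OF that(1,2)] that(3) unfolding dist_real_def by linarith
      then show "\<forall>\<^sub>F N in sequentially. outer_measure_of M {\<omega> \<in> space M. \<epsilon> < dist (Z N \<omega>) c}
          \<le> outer_measure_of M {\<omega> \<in> space M. \<epsilon> / 2 < dist (V N \<omega>) 0}"
        by (intro eventually_sequentiallyI[of 1] outer_measure_of_mono) auto
    qed simp
  qed
  then show ?thesis
    using In_Probability by (simp add: tendsto_outer_mode_def tendsto_outer_prob_def)
next
  case Almost_Surely
  define r where "r n = inverse (real (Suc n))" for n
  have r: "r n > 0" for n by (simp add: r_def)
  define V where "V n = (SOME V :: nat \<Rightarrow> 'a \<Rightarrow> real. (\<forall>N\<ge>1. V N \<in> borel_measurable M) \<and>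
    tendsto_mode m M V 0 \<and> (\<forall>N\<ge>1. \<forall>\<omega>\<in>space M. dist (Z N \<omega>) c \<le> r n + V N \<omega>))" for n
  have V: "(\<forall>N\<ge>1. V n N \<in> borel_measurable M) \<and> tendsto_mode m M (V n) 0 \<and>
      (\<forall>N\<ge>1. \<forall>\<omega>\<in>space M. dist (Z N \<omega>) c \<le> r n + V n N \<omega>)" for n
    unfolding V_def by (rule someI_ex[OF assms[OF r]])
  then have le: "dist (Z N \<omega>) c \<le> r n + V n N \<omega>" if "N \<ge> 1" "\<omega> \<in> space M" for N \<omega> n
    using that by simp
  \<comment> \<open>The distance bounds the whole family from below, so the infimum over the reals
    is meaningful and still dominates the distance.\<close>
  have bdd: "bdd_below (range (\<lambda>n. r n + V n N \<omega>))" if "N \<ge> 1" "\<omega> \<in> space M" for N \<omega>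
    by (rule bdd_belowI2[of _ "dist (Z N \<omega>) c"]) (rule le[OF that])
  define \<Delta> where "\<Delta> N \<omega> = (INF n. r n + V n N \<omega>)" for N \<omega>
  have meas: "\<Delta> N \<in> borel_measurable M" if "N \<ge> 1" for N
    unfolding \<Delta>_def using V that bdd[OF that]
    by (intro borel_measurable_cINF borel_measurable_add) simp_all
  have dom: "dist (Z N \<omega>) c \<le> \<Delta> N \<omega>" if "N \<ge> 1" "\<omega> \<in> space M" for N \<omega>
    unfolding \<Delta>_def by (rule cINF_greatest) (simp_all add: le[OF that])
  have "AE \<omega> in M. \<forall>n. (\<lambda>N. V n N \<omega>) \<longlonglongrightarrow> 0"
    unfolding AE_all_countable using V Almost_Surely by (simp add: tendsto_mode_def)
  then have "AE \<omega> in M. (\<lambda>N. \<Delta> N \<omega>) \<longlonglongrightarrow> 0"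
  proof (rule AE_mp, intro AE_I2 impI)
    fix \<omega> assume \<omega>: "\<omega> \<in> space M" and lim: "\<forall>n. (\<lambda>N. V n N \<omega>) \<longlonglongrightarrow> 0"
    show "(\<lambda>N. \<Delta> N \<omega>) \<longlonglongrightarrow> 0"
    proof (rule LIMSEQ_I)
      fix e :: real assume "e > 0"
      then obtain n where n: "r n < e / 2"
        using reals_Archimedean[of "e / 2"] unfolding r_def by auto
      obtain N0 where N0: "\<And>N. N \<ge> N0 \<Longrightarrow> norm (V n N \<omega> - 0) < e / 2"
        using LIMSEQ_D[OF lim[rule_format, of n], of "e / 2"] \<open>e > 0\<close> by auto
      have "norm (\<Delta> N \<omega> - 0) < e" if "N \<ge> max 1 N0" for N
      proof -
        have N: "N \<ge> 1" "N \<ge> N0" using that by auto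
        have "\<Delta> N \<omega> \<le> r n + V n N \<omega>"
          unfolding \<Delta>_def by (rule cINF_lower[OF bdd[OF N(1) \<omega>]]) simp
        moreover have "0 \<le> \<Delta> N \<omega>"
          using dom[OF N(1) \<omega>] zero_le_dist[of "Z N \<omega>" c] by linarith
        ultimately show ?thesis using N0[OF N(2)] n by simp
      qed
      then show "\<exists>N0. \<forall>N\<ge>N0. norm (\<Delta> N \<omega> - 0) < e" by blast
    qed
  qed
  then show ?thesis
    using Almost_Surely meas dom unfolding tendsto_outer_mode_def tendsto_outer_as_def
    by (simp, intro exI[of _ \<Delta>]) simp
qed

section \<open>Weighted averages of random paths\<close>

lemma lin_comb_measurable:
  assumes Z: "\<And>f. f \<in> F \<Longrightarrow> (\<lambda>\<omega>. Z \<omega> f) \<in> borel_measurable M" and "snd ` set xs \<subseteq> F"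
  shows "(\<lambda>\<omega>. lin_comb xs (Z \<omega>)) \<in> borel_measurable M"
  using assms(2)
proof (induction xs)
  case (Cons a xs)
  obtain t f where a: "a = (t, f)" by force
  have "(\<lambda>\<omega>. t * Z \<omega> f + lin_comb xs (Z \<omega>)) \<in> borel_measurable M"
    using Cons a Z[of f] by (intro borel_measurable_add borel_measurable_times) auto
  then show ?case by (simp add: a)
qed simp

text \<open>A trigonometric function sees finitely many coordinates, so coordinatewise measurability
  is enough and \<open>Z\<close> may fail to be measurable as a random path.\<close>

lemma trig_measurable:
  assumes Z: "\<And>f. f \<in> F \<Longrightarrow> (\<lambda>\<omega>. Z \<omega> f) \<in> borel_measurable M" and "g \<in> trig F"
  shows "(\<lambda>\<omega>. g (Z \<omega>)) \<in> borel_measurable M"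
  using assms(2)
proof induction
  case (cos xs)
  from lin_comb_measurable[OF Z this] show ?case by measurable
next
  case (sin xs)
  from lin_comb_measurable[OF Z this] show ?case by measurable
next
  case (add g h)
  show ?case by (rule borel_measurable_add[OF add.IH])
next
  case (scale g c)
  show ?case by (rule borel_measurable_times[OF borel_measurable_const scale.IH])
qed

text \<open>In the application \<open>s\<close> is a binary vector, \<open>w N s \<omega>\<close> its selection probability and \<open>\<Phi> N s \<omega>\<close>
  the corresponding value of the process, so that \<open>avg N g\<close> is the design expectation of \<open>g\<close>.\<close>

locale random_weights = M: prob_space M + M': prob_space M'
  for M :: "'w measure" and M' :: "'c measure" +
  fixes F :: "'f set" and H' :: "'f \<Rightarrow> 'c \<Rightarrow> real" and m :: conv_mode
    and I :: "nat \<Rightarrow> 's set" and w :: "nat \<Rightarrow> 's \<Rightarrow> 'w \<Rightarrow> real"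
    and \<Phi> :: "nat \<Rightarrow> 's \<Rightarrow> 'w \<Rightarrow> 'f \<Rightarrow> real"
  assumes w_nonneg: "\<And>N \<omega> s. N \<ge> 1 \<Longrightarrow> \<omega> \<in> space M \<Longrightarrow> s \<in> I N \<Longrightarrow> 0 \<le> w N s \<omega>"
    and w_sum: "\<And>N \<omega>. N \<ge> 1 \<Longrightarrow> \<omega> \<in> space M \<Longrightarrow> (\<Sum>s\<in>I N. w N s \<omega>) = 1"
    and w_supp: "\<And>N \<omega> s. N \<ge> 1 \<Longrightarrow> \<omega> \<in> space M \<Longrightarrow> s \<in> I N \<Longrightarrow> w N s \<omega> \<noteq> 0 \<Longrightarrow>
      \<Phi> N s \<omega> \<in> mspace (linf F)"
    and H'_measurable: "\<And>f. f \<in> F \<Longrightarrow> H' f \<in> borel_measurable M'"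
begin

definition avg :: "nat \<Rightarrow> (('f \<Rightarrow> real) \<Rightarrow> real) \<Rightarrow> 'w \<Rightarrow> real" where
  "avg N g \<omega> = (\<Sum>s\<in>I N. w N s \<omega> * g (\<Phi> N s \<omega>))"

abbreviation path :: "'c \<Rightarrow> 'f \<Rightarrow> real" where
  "path \<xi> \<equiv> \<lambda>f. H' f \<xi>"

lemma avg_add: "avg N (\<lambda>z. g z + h z) \<omega> = avg N g \<omega> + avg N h \<omega>"
  by (simp add: avg_def distrib_left sum.distrib)

lemma avg_scale: "avg N (\<lambda>z. c * g z) \<omega> = c * avg N g \<omega>"
  by (simp add: avg_def sum_distrib_left mult.left_commute)

lemma avg_const: "N \<ge> 1 \<Longrightarrow> \<omega> \<in> space M \<Longrightarrow> avg N (\<lambda>z. c) \<omega> = c"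
  by (simp add: avg_def sum_distrib_right[symmetric] w_sum)

text \<open>Paths of weight zero may lie outside the carrier of \<open>linf F\<close>, where nothing
  is known of \<open>g\<close> and \<open>h\<close>; their terms vanish on both sides.\<close>

lemma avg_mono:
  assumes "N \<ge> 1" "\<omega> \<in> space M" "\<And>z. z \<in> mspace (linf F) \<Longrightarrow> g z \<le> h z"
  shows "avg N g \<omega> \<le> avg N h \<omega>"
  unfolding avg_def
proof (rule sum_mono)
  fix s assume s: "s \<in> I N"
  show "w N s \<omega> * g (\<Phi> N s \<omega>) \<le> w N s \<omega> * h (\<Phi> N s \<omega>)"
  proof (cases "w N s \<omega> = 0")
    case False
    then show ?thesis
      using w_nonneg[OF assms(1,2) s] w_supp[OF assms(1,2) s] assms(3) by (intro mult_left_mono) auto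
  qed simp
qed

text \<open>The pointwise error is at most \<open>a\<close> on \<open>U\<close> and
  \<open>a + b\<close> off it, so averaging charges \<open>b\<close> only to the weight outside
  \<open>U\<close>. This concerns a finite sum at one sample point and so applies to nonmeasurable
  \<open>h\<close> and \<open>U\<close>.\<close>

lemma avg_diff_le:
  assumes N: "N \<ge> 1" "\<omega> \<in> space M"
    and le: "\<And>z. z \<in> mspace (linf F) \<Longrightarrow> \<bar>g z - h z\<bar> \<le> a + b * (1 - of_bool (z \<in> U))"
  shows "\<bar>avg N g \<omega> - avg N h \<omega>\<bar> \<le> a + b * (1 - avg N (\<lambda>z. of_bool (z \<in> U)) \<omega>)"
proof -
  let ?k = "\<lambda>z. (a + b) + (- b) * of_bool (z \<in> U)"
  have k: "avg N ?k \<omega> = a + b * (1 - avg N (\<lambda>z. of_bool (z \<in> U)) \<omega>)"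
    by (simp only: avg_add avg_scale avg_const[OF N]) (simp add: algebra_simps)
  have le': "g z \<le> h z + ?k z" "h z \<le> g z + ?k z" if "z \<in> mspace (linf F)" for z
    using le[OF that] by (auto simp: algebra_simps abs_le_iff)
  have "avg N g \<omega> \<le> avg N h \<omega> + avg N ?k \<omega>" "avg N h \<omega> \<le> avg N g \<omega> + avg N ?k \<omega>"
    unfolding avg_add[symmetric] by (intro avg_mono[OF N] le'; assumption)+
  then show ?thesis unfolding k by linarith
qed

lemma trig_path_measurable: "g \<in> trig F \<Longrightarrow> (\<lambda>\<xi>. g (path \<xi>)) \<in> borel_measurable M'"
  by (rule trig_measurable[OF H'_measurable])

lemma trig_path_integrable:
  assumes "g \<in> trig F"
  shows "integrable M' (\<lambda>\<xi>. g (path \<xi>))"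
proof -
  obtain B where "\<And>z. \<bar>g z\<bar> \<le> B" using trig_bounded[OF assms] by blast
  then show ?thesis
    by (intro M'.integrable_const_bound[of _ B] trig_path_measurable assms) auto
qed

text \<open>With countably many coordinates, the Borel sets of the product topology are generated by
  the coordinates.\<close>

lemma coordinates_path_measurable:
  fixes g :: "nat \<Rightarrow> ('f \<Rightarrow> real) \<Rightarrow> real"
  assumes "\<And>k. g k \<in> trig F"
  shows "(\<lambda>\<xi> k. g k (path \<xi>)) \<in> borel_measurable M'"
  by (rule measurable_coordinatewise_then_product) (rule trig_path_measurable[OF assms])

end

text \<open>A limit below \<open>c\<close> would be missed by a fixed margin at every sample point,
  so the deviation event would be the whole space, of probability one. In the almost sure mode the
  bound passes to the limit at almost every point.\<close>

lemma (in prob_space) tendsto_mode_lower_bound: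
  fixes V :: "nat \<Rightarrow> 'a \<Rightarrow> real"
  assumes V: "tendsto_mode m M V v" and le: "\<And>N \<omega>. N \<ge> 1 \<Longrightarrow> \<omega> \<in> space M \<Longrightarrow> c \<le> V N \<omega>"
  shows "c \<le> v"
proof (cases m)
  case In_Probability
  show ?thesis
  proof (rule ccontr)
    assume "\<not> c \<le> v"
    then have "v < c" by simp
    then obtain e where e: "e > 0" "v + e < c"
      using dense[of v c] by (metis add.commute diff_add_cancel diff_gt_0_iff_gt)
    have "(\<lambda>N. outer_measure_of M {\<omega> \<in> space M. e < dist (V N \<omega>) v}) \<longlonglongrightarrow> 0"
      using V e(1) unfolding tendsto_mode_def tendsto_outer_prob_def In_Probability conv_mode.case by blast
    moreover have "outer_measure_of M {\<omega> \<in> space M. e < dist (V N \<omega>) v} = 1" if "N \<ge> 1" for N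
    proof -
      have "e < dist (V N \<omega>) v" if "\<omega> \<in> space M" for \<omega>
        using le[OF \<open>N \<ge> 1\<close> that] e unfolding dist_real_def by linarith
      then have "{\<omega> \<in> space M. e < dist (V N \<omega>) v} = space M" by auto
      then show ?thesis by (simp add: emeasure_space_1)
    qed
    then have "(\<lambda>N. outer_measure_of M {\<omega> \<in> space M. e < dist (V N \<omega>) v}) \<longlonglongrightarrow> 1"
      by (intro tendsto_eventually eventually_sequentiallyI[of 1])
    ultimately show False using LIMSEQ_unique zero_neq_one by blast
  qed
next
  case Almost_Surely
  then have "AE \<omega> in M. (\<lambda>N. V N \<omega>) \<longlonglongrightarrow> v"
    using V by (simp add: tendsto_mode_def)
  then have "AE \<omega> in M. c \<le> v"
  proof (rule AE_mp, intro AE_I2 impI)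
    fix \<omega> assume "\<omega> \<in> space M" "(\<lambda>N. V N \<omega>) \<longlonglongrightarrow> v"
    then show "c \<le> v" using le by (intro LIMSEQ_le_const[of "\<lambda>N. V N \<omega>"]) auto
  qed
  then show ?thesis by simp
qed

section \<open>Concentration of the limit on compact sets\<close>

context random_weights
begin

text \<open>The content of (CAT) for one fixed \<open>K\<close> and \<eta>; the corrections
  \<open>A\<close> may depend on \<delta>, the set \<open>K\<close> may not.\<close>

definition asymptotically_tight_in :: "('f \<Rightarrow> real) set \<Rightarrow> real \<Rightarrow> bool" where
  "asymptotically_tight_in K \<eta> \<longleftrightarrow> (\<forall>\<delta>>0. \<exists>A :: nat \<Rightarrow> 'w \<Rightarrow> real.
     (\<forall>N\<ge>1. A N \<in> borel_measurable M) \<and> tendsto_mode m M A 0 \<and>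
     (\<forall>N\<ge>1. \<forall>\<omega>\<in>space M. avg N (\<lambda>z. of_bool (z \<in> enlargement F K \<delta>)) \<omega> + A N \<omega> \<ge> 1 - \<eta>))"

text \<open>A trigonometric \<open>T\<close> close to \<open>G\<close> of the coordinates is
  Lipschitz, hence almost 1 on a small enlargement of \<open>K\<close> and almost nonnegative
  elsewhere. Up to \<open>2 * \<epsilon>\<close> it majorizes the indicator of the enlargement, so
  the bound of (CAT) passes to the limit; a third \<epsilon> pays for the return from
  \<open>T\<close> to \<open>G\<close>.\<close>

lemma limit_concentrated_aux:
  fixes g :: "nat \<Rightarrow> ('f \<Rightarrow> real) \<Rightarrow> real"
  assumes conv: "\<And>g. g \<in> trig F \<Longrightarrow> tendsto_mode m M (\<lambda>N. avg N g) (\<integral>\<xi>. g (path \<xi>) \<partial>M')"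
    and KF: "K \<subseteq> mspace (linf F)" and tight: "asymptotically_tight_in K \<eta>"
    and g: "\<And>k. g k \<in> trig F" "\<And>k z. \<bar>g k z\<bar> \<le> 1"
    and G: "continuous_on UNIV G" "\<And>x. 0 \<le> G x" "\<And>x. G x \<le> 1"
      "\<And>z. z \<in> K \<Longrightarrow> G (\<lambda>k. g k z) = 1"
  shows "1 - \<eta> \<le> (\<integral>\<xi>. G (\<lambda>k. g k (path \<xi>)) \<partial>M')"
proof (rule field_le_epsilon)
  fix e :: real assume "e > 0"
  define \<epsilon> where "\<epsilon> = e / 3"
  have \<epsilon>: "\<epsilon> > 0" "e = 3 * \<epsilon>" using \<open>e > 0\<close> by (auto simp: \<epsilon>_def)
  obtain T where T: "T \<in> trig F" "\<And>z. \<bar>T z - G (\<lambda>k. g k z)\<bar> < \<epsilon>"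
    using trig_approx[of g, OF g G(1) \<epsilon>(1)] by blast
  obtain L where L: "L \<ge> 0" "\<And>z z'. z \<in> mspace (linf F) \<Longrightarrow> z' \<in> mspace (linf F) \<Longrightarrow>
      \<bar>T z - T z'\<bar> \<le> L * mdist (linf F) z z'"
    using trig_Lipschitz[OF T(1)] by blast
  \<comment> \<open>The radius is matched to the Lipschitz constant of \<open>T\<close>; the added 1
    avoids division by zero.\<close>
  define \<delta> where "\<delta> = \<epsilon> / (L + 1)"
  have \<delta>: "\<delta> > 0" "L * \<delta> \<le> \<epsilon>"
    using \<epsilon>(1) L(1) by (auto simp: \<delta>_def field_simps)
  obtain A where A: "tendsto_mode m M A (0::real)"
    "\<forall>N\<ge>1. \<forall>\<omega>\<in>space M. 1 - \<eta> \<le> avg N (\<lambda>z. of_bool (z \<in> enlargement F K \<delta>)) \<omega> + A N \<omega>"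
    using tight[unfolded asymptotically_tight_in_def, rule_format, OF \<delta>(1)] by (elim exE conjE)
  have T_lower: "of_bool (z \<in> enlargement F K \<delta>) + (- (2 * \<epsilon>)) \<le> T z" if z: "z \<in> mspace (linf F)" for z
  proof (cases "z \<in> enlargement F K \<delta>")
    case True
    then obtain z' where z': "z' \<in> K" "mdist (linf F) z z' < \<delta>"
      unfolding enlargement_def by blast
    have "\<bar>T z - T z'\<bar> \<le> L * mdist (linf F) z z'" using L(2)[OF z] z'(1) KF by blast
    also have "\<dots> \<le> L * \<delta>" using z'(2) L(1) by (intro mult_left_mono) auto
    finally have "\<bar>T z - T z'\<bar> \<le> \<epsilon>" using \<delta>(2) by linarith
    moreover have "1 - \<epsilon> \<le> T z'" using T(2)[of z'] G(4)[OF z'(1)] by linarith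
    ultimately show ?thesis using True by simp
  next
    case False
    have "- \<epsilon> \<le> T z" using T(2)[of z] G(2)[of "\<lambda>k. g k z"] by linarith
    then show ?thesis using False \<epsilon>(1) by simp
  qed
  have "1 - \<eta> - 2 * \<epsilon> \<le> (\<integral>\<xi>. T (path \<xi>) \<partial>M') + 0"
  proof (rule M.tendsto_mode_lower_bound[OF tendsto_mode_add[OF conv[OF T(1)] A(1)]])
    fix N \<omega> assume N: "(N::nat) \<ge> 1" "\<omega> \<in> space M"
    have "avg N (\<lambda>z. of_bool (z \<in> enlargement F K \<delta>) + (- (2 * \<epsilon>))) \<omega> \<le> avg N T \<omega>"
      by (intro avg_mono[OF N] T_lower)
    then show "1 - \<eta> - 2 * \<epsilon> \<le> avg N T \<omega> + A N \<omega>"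
      using A(2)[rule_format, OF N] unfolding avg_add avg_const[OF N] by linarith
  qed
  moreover have Gint: "integrable M' (\<lambda>\<xi>. G (\<lambda>k. g k (path \<xi>)))"
  proof (rule M'.integrable_const_bound[of _ 1])
    show "(\<lambda>\<xi>. G (\<lambda>k. g k (path \<xi>))) \<in> borel_measurable M'"
      by (rule measurable_compose[OF coordinates_path_measurable[of g, OF g(1)]
            borel_measurable_continuous_onI[OF G(1)]])
  qed (use G(2,3) in simp_all)
  moreover have "(\<integral>\<xi>. T (path \<xi>) \<partial>M') \<le> (\<integral>\<xi>. G (\<lambda>k. g k (path \<xi>)) + \<epsilon> \<partial>M')"
  proof (rule integral_mono)
    show "integrable M' (\<lambda>\<xi>. G (\<lambda>k. g k (path \<xi>)) + \<epsilon>)"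
      by (rule Bochner_Integration.integrable_add[OF Gint M'.integrable_const])
    show "integrable M' (\<lambda>\<xi>. T (path \<xi>))" by (rule trig_path_integrable[OF T(1)])
    show "T (path \<xi>) \<le> G (\<lambda>k. g k (path \<xi>)) + \<epsilon>" for \<xi>
      using T(2)[of "path \<xi>"] by linarith
  qed
  moreover have "(\<integral>\<xi>. G (\<lambda>k. g k (path \<xi>)) + \<epsilon> \<partial>M') = (\<integral>\<xi>. G (\<lambda>k. g k (path \<xi>)) \<partial>M') + \<epsilon>"
    using Gint by (simp add: M'.prob_space)
  ultimately show "1 - \<eta> \<le> (\<integral>\<xi>. G (\<lambda>k. g k (path \<xi>)) \<partial>M') + e"
    unfolding \<epsilon>(2) by linarith
qed

text \<open>The indicator of the compact image of \<open>K\<close> in the Hilbert cube is approximated from above by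
  continuous functions of the distance to it.\<close>

lemma limit_concentrated:
  fixes g :: "nat \<Rightarrow> ('f \<Rightarrow> real) \<Rightarrow> real"
  assumes conv: "\<And>g. g \<in> trig F \<Longrightarrow> tendsto_mode m M (\<lambda>N. avg N g) (\<integral>\<xi>. g (path \<xi>) \<partial>M')"
    and K: "compactin (mtopology_of (linf F)) K" and tight: "asymptotically_tight_in K \<eta>"
    and g: "\<And>k. g k \<in> trig F" "\<And>k z. \<bar>g k z\<bar> \<le> 1"
  shows "1 - \<eta> \<le> measure M' {\<xi> \<in> space M'. (\<lambda>k. g k (path \<xi>)) \<in> (\<lambda>z k. g k z) ` K}"
proof (cases "K = {}")
  \<comment> \<open>By convention \<open>infdist\<close> to the empty set is 0, which would make the
    functions \<open>G j\<close> of the other case constantly 1; the zero function is used here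
    instead.\<close>
  case True
  have "1 - \<eta> \<le> (\<integral>\<xi>. 0 \<partial>M')"
    by (rule limit_concentrated_aux[of K \<eta> g "\<lambda>x. 0"])
      (use conv tight g True in \<open>simp_all\<close>)
  then show ?thesis using True by simp
next
  case False
  define C where "C = (\<lambda>z k. g k z) ` K"
  have C: "closed C" "C \<noteq> {}"
    unfolding C_def using False compact_imp_closed[OF compact_trig_image[of g, OF g(1) K]] by auto
  define G where "G j x = max 0 (1 - real j * infdist x C)" for j and x :: "nat \<Rightarrow> real"
  have contG: "continuous_on UNIV (G j)" for j
    unfolding G_def by (intro continuous_intros)
  have G01: "0 \<le> G j x" "G j x \<le> 1" for j x
    by (auto simp: G_def infdist_nonneg)
  have G1: "G j x = 1" if "x \<in> C" for j x
    using that C by (simp add: G_def in_closed_iff_infdist_zero)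
  have lim: "(\<lambda>j. G j x) \<longlonglongrightarrow> indicator C x" for x
  proof (cases "x \<in> C")
    case True
    then show ?thesis using G1 by simp
  next
    case F: False
    then have pos: "infdist x C > 0" by (rule infdist_pos_not_in_closed[OF C])
    obtain j0 :: nat where j0: "1 / infdist x C < real j0" using reals_Archimedean2 by blast
    have "G j x = 0" if "j \<ge> j0" for j
    proof -
      have "1 / infdist x C \<le> real j" using j0 that by linarith
      then have "1 \<le> real j * infdist x C" using pos by (simp add: pos_divide_le_eq)
      then show ?thesis by (simp add: G_def)
    qed
    then show ?thesis using F
      by (intro tendsto_eventually eventually_sequentiallyI[of j0]) simp
  qed
  let ?X = "\<lambda>\<xi> k. g k (path \<xi>)"
  have X: "?X \<in> borel_measurable M'" by (rule coordinates_path_measurable[of g, OF g(1)])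
  have Cb: "C \<in> sets borel" using C(1) by simp
  have ev: "{\<xi> \<in> space M'. ?X \<xi> \<in> C} \<in> sets M'"
    using measurable_sets[OF X Cb] by (simp add: vimage_def Int_def conj_commute)
  have "(\<lambda>j. \<integral>\<xi>. G j (?X \<xi>) \<partial>M') \<longlonglongrightarrow> (\<integral>\<xi>. indicator C (?X \<xi>) \<partial>M')"
  proof (rule integral_dominated_convergence[where w = "\<lambda>_. 1"])
    show "(\<lambda>\<xi>. G j (?X \<xi>)) \<in> borel_measurable M'" for j
      by (rule measurable_compose[OF X borel_measurable_continuous_onI[OF contG]])
    show "(\<lambda>\<xi>. indicator C (?X \<xi>) :: real) \<in> borel_measurable M'"
      by (rule measurable_compose[OF X borel_measurable_indicator[OF Cb]])
  qed (use lim G01 in simp_all)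
  moreover have "(\<integral>\<xi>. indicator C (?X \<xi>) \<partial>M') = measure M' {\<xi> \<in> space M'. ?X \<xi> \<in> C}"
  proof -
    have "(\<integral>\<xi>. indicator C (?X \<xi>) \<partial>M') = (\<integral>\<xi>. indicator {\<xi> \<in> space M'. ?X \<xi> \<in> C} \<xi> \<partial>M' :: real)"
      by (rule Bochner_Integration.integral_cong) (simp_all add: indicator_def)
    then show ?thesis using ev by simp
  qed
  moreover have "1 - \<eta> \<le> (\<integral>\<xi>. G j (?X \<xi>) \<partial>M')" for j
    by (rule limit_concentrated_aux[of K \<eta> g "G j", OF conv compactin_linf_subset[OF K] tight g contG G01])
      (simp_all add: G1 C_def)
  ultimately show ?thesis
    unfolding C_def[symmetric] by (intro LIMSEQ_le_const[where X = "\<lambda>j. \<integral>\<xi>. G j (?X \<xi>) \<partial>M'"]) auto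
qed

end

section \<open>The limiting random path\<close>

text \<open>Measurability and convergence are required of trigonometric test functions only, as the
  average of a general \<open>g\<close> may be nonmeasurable.\<close>

locale conditionally_convergent = random_weights M M' F H' m I w \<Phi>
  for M :: "'w measure" and M' :: "'c measure" and F :: "'f set" and H' m
    and I :: "nat \<Rightarrow> 's set" and w \<Phi> +
  assumes avg_measurable: "\<And>N g. N \<ge> 1 \<Longrightarrow> g \<in> trig F \<Longrightarrow> avg N g \<in> borel_measurable M"
    and conv: "\<And>g. g \<in> trig F \<Longrightarrow> tendsto_mode m M (\<lambda>N. avg N g) (\<integral>\<xi>. g (path \<xi>) \<partial>M')"
    and tight: "\<And>\<eta>. \<eta> > 0 \<Longrightarrow>
      \<exists>K. compactin (mtopology_of (linf F)) K \<and> asymptotically_tight_in K \<eta>"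
begin

definition K :: "nat \<Rightarrow> ('f \<Rightarrow> real) set" where
  "K n = (SOME K. compactin (mtopology_of (linf F)) K \<and> asymptotically_tight_in K (inverse (real (Suc n))))"

lemma K: "compactin (mtopology_of (linf F)) (K n)" "asymptotically_tight_in (K n) (inverse (real (Suc n)))"
proof -
  have "inverse (real (Suc n)) > 0" by simp
  from someI_ex[OF tight[OF this]]
  show "compactin (mtopology_of (linf F)) (K n)" "asymptotically_tight_in (K n) (inverse (real (Suc n)))"
    unfolding K_def by (rule conjunct1, rule conjunct2)
qed

definition X :: "('f \<Rightarrow> real) set" where
  "X = (\<Union>n. K n)"

lemma K_subset_X: "K n \<subseteq> X"
  unfolding X_def by blast

lemma X_subset: "X \<subseteq> mspace (linf F)"
  unfolding X_def by (rule UN_least, rule compactin_linf_subset[OF K(1)])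

definition separating :: "'f set" where
  "separating = (SOME A. countable A \<and> A \<subseteq> F \<and> (\<forall>z\<in>X. \<forall>z'\<in>X. (\<forall>f\<in>A. z f = z' f) \<longrightarrow> z = z'))"

lemma separating:
  "countable separating" "separating \<subseteq> F"
  "\<forall>z\<in>X. \<forall>z'\<in>X. (\<forall>f\<in>separating. z f = z' f) \<longrightarrow> z = z'"
proof -
  have *: "countable separating \<and> separating \<subseteq> F \<and>
    (\<forall>z\<in>X. \<forall>z'\<in>X. (\<forall>f\<in>separating. z f = z' f) \<longrightarrow> z = z')"
    unfolding separating_def X_def by (rule someI_ex, rule countable_separating_set, rule K(1))
  show "countable separating" "separating \<subseteq> F"
    "\<forall>z\<in>X. \<forall>z'\<in>X. (\<forall>f\<in>separating. z f = z' f) \<longrightarrow> z = z'"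
    by (rule conjunct1[OF *], rule conjunct1[OF conjunct2[OF *]], rule conjunct2[OF conjunct2[OF *]])
qed

definition coord :: "nat \<Rightarrow> ('f \<Rightarrow> real) \<Rightarrow> real" where
  "coord = (SOME g. (\<forall>k. g k \<in> trig F) \<and> (\<forall>k z. \<bar>g k z\<bar> \<le> 1) \<and>
    (\<forall>z z'. (\<forall>k. g k z = g k z') \<longleftrightarrow> (\<forall>f\<in>separating. z f = z' f)))"

lemma coord: "coord k \<in> trig F" "\<bar>coord k z\<bar> \<le> 1"
  "(\<forall>k. coord k z = coord k z') \<longleftrightarrow> (\<forall>f\<in>separating. z f = z' f)"
proof -
  have *: "(\<forall>k. coord k \<in> trig F) \<and> (\<forall>k z. \<bar>coord k z\<bar> \<le> 1) \<and>
    (\<forall>z z'. (\<forall>k. coord k z = coord k z') \<longleftrightarrow> (\<forall>f\<in>separating. z f = z' f))"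
    unfolding coord_def by (rule someI_ex[OF trig_coordinates[OF separating(1,2)]])
  show "coord k \<in> trig F" using * by blast
  show "\<bar>coord k z\<bar> \<le> 1" using * by blast
  show "(\<forall>k. coord k z = coord k z') \<longleftrightarrow> (\<forall>f\<in>separating. z f = z' f)"
    using conjunct2[OF conjunct2[OF *]] by (elim allE)
qed

definition \<iota> :: "('f \<Rightarrow> real) \<Rightarrow> nat \<Rightarrow> real" where
  "\<iota> = (\<lambda>z k. coord k z)"

lemma \<iota>_eq_iff: "\<iota> z = \<iota> z' \<longleftrightarrow> (\<forall>f\<in>separating. z f = z' f)"
  unfolding coord(3)[symmetric] by (simp add: \<iota>_def fun_eq_iff)

lemma inj_on_\<iota>: "inj_on \<iota> X"
  by (rule inj_onI) (simp add: \<iota>_eq_iff separating(3))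

lemma limit_concentrated_K:
  fixes g :: "nat \<Rightarrow> ('f \<Rightarrow> real) \<Rightarrow> real"
  assumes "\<And>k. g k \<in> trig F" "\<And>k z. \<bar>g k z\<bar> \<le> 1"
  shows "1 - inverse (real (Suc n)) \<le>
    measure M' {\<xi> \<in> space M'. (\<lambda>k. g k (path \<xi>)) \<in> (\<lambda>z k. g k z) ` K n}"
  by (rule limit_concentrated[of "K n" "inverse (real (Suc n))" g, OF conv K assms])

lemma X_nonempty: "X \<noteq> {}"
proof
  assume "X = {}"
  \<comment> \<open>At \<open>n = 0\<close> the concentration bound is the trivial 0; at
    \<open>n = 1\<close> it is one half and excludes an empty set.\<close>
  then have "K 1 = {}" using K_subset_X[of 1] by simp
  then show False
    using limit_concentrated_K[of coord 1, OF coord(1,2)] by simp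
qed

text \<open>Off the event, of probability one, that the embedded path of \<open>H'\<close> lies in
  the image of \<open>X\<close>, a fixed member of \<open>X\<close> is used; hence every value is a
  bounded function.\<close>

definition limit_path :: "'c \<Rightarrow> 'f \<Rightarrow> real" where
  "limit_path \<xi> = (if \<iota> (path \<xi>) \<in> \<iota> ` X then inv_into X \<iota> (\<iota> (path \<xi>)) else (SOME z. z \<in> X))"

lemma limit_path_in: "limit_path \<xi> \<in> X"
  using X_nonempty unfolding limit_path_def by (simp add: inv_into_into some_in_eq)

lemma limit_path_eqI: "z \<in> X \<Longrightarrow> \<iota> (path \<xi>) = \<iota> z \<Longrightarrow> limit_path \<xi> = z"
  unfolding limit_path_def using inv_into_f_f[OF inj_on_\<iota>, of z] by simp

lemma path_measurable: "(\<lambda>\<xi>. \<iota> (path \<xi>)) \<in> borel_measurable M'"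
  unfolding \<iota>_def by (rule coordinates_path_measurable[of coord, OF coord(1)])

text \<open>\<open>X\<close> is a countable union of compact sets, and each piece
  \<open>K n \<inter> C\<close> has a compact, hence closed, image.\<close>

lemma \<iota>_image_borel:
  assumes "closedin (mtopology_of (linf F)) C"
  shows "\<iota> ` (X \<inter> C) \<in> sets borel"
proof -
  have "\<iota> ` (X \<inter> C) = (\<Union>n. \<iota> ` (K n \<inter> C))" unfolding X_def by blast
  moreover have "\<iota> ` (K n \<inter> C) \<in> sets borel" for n
    using compact_trig_image[of coord, OF coord(1) compact_Int_closedin[OF K(1) assms]]
    by (intro borel_closed compact_imp_closed) (simp add: \<iota>_def)
  ultimately show ?thesis by simp
qed

lemma limit_path_measurable: "limit_path \<in> M' \<rightarrow>\<^sub>M borel_linf F"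
proof (rule measurable_borel_linfI)
  show "limit_path \<xi> \<in> mspace (linf F)" for \<xi>
    using limit_path_in X_subset by blast
  fix C assume C: "closedin (mtopology_of (linf F)) C"
  have pre: "{\<xi> \<in> space M'. \<iota> (path \<xi>) \<in> B} \<in> sets M'" if "B \<in> sets borel" for B
    using measurable_sets[OF path_measurable that] by (simp add: vimage_def Int_def conj_commute)
  let ?z = "SOME z. z \<in> X"
  have X_borel: "\<iota> ` X \<in> sets borel"
    using \<iota>_image_borel[OF closedin_topspace] X_subset by (simp add: Int_absorb2)
  \<comment> \<open>Injectivity on \<open>X\<close> turns this into membership of the embedded path
    in a Borel set; the default value contributes the whole complement of the image or
    nothing.\<close>
  have "limit_path \<xi> \<in> C \<longleftrightarrow> \<iota> (path \<xi>) \<in> \<iota> ` (X \<inter> C) \<union> (if ?z \<in> C then - (\<iota> ` X) else {})" for \<xi>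
  proof (cases "\<iota> (path \<xi>) \<in> \<iota> ` X")
    case True
    then obtain z where z: "z \<in> X" "\<iota> (path \<xi>) = \<iota> z" by blast
    have "\<iota> z \<in> \<iota> ` (X \<inter> C) \<longleftrightarrow> z \<in> C"
      using z(1) inj_on_\<iota> by (auto simp: inj_on_def)
    moreover have "\<iota> z \<in> \<iota> ` X" using z(1) by blast
    ultimately show ?thesis using limit_path_eqI[OF z] z(2) by simp
  next
    case False
    then have "\<iota> (path \<xi>) \<notin> \<iota> ` (X \<inter> C)" by blast
    then show ?thesis using False by (simp add: limit_path_def)
  qed
  then have "{\<xi> \<in> space M'. limit_path \<xi> \<in> C} =
    {\<xi> \<in> space M'. \<iota> (path \<xi>) \<in> \<iota> ` (X \<inter> C) \<union> (if ?z \<in> C then - (\<iota> ` X) else {})}" by simp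
  also have "\<dots> \<in> sets M'"
    by (rule pre) (simp add: X_borel \<iota>_image_borel[OF C] sets.Un borel_comp)
  finally show "{\<xi> \<in> space M'. limit_path \<xi> \<in> C} \<in> sets M'" .
qed

lemma limit_path_event: "closedin (mtopology_of (linf F)) C \<Longrightarrow> {\<xi> \<in> space M'. limit_path \<xi> \<in> C} \<in> sets M'"
  using measurable_sets[OF limit_path_measurable closedin_borel_linf[of F C]]
  by (simp add: vimage_def Int_def conj_commute)

text \<open>If the embedded path lies in the image of \<open>K n\<close>, its unique preimage in
  \<open>X\<close> already belongs to \<open>K n\<close>.\<close>

lemma limit_path_tight:
  "1 - inverse (real (Suc n)) \<le> measure M' {\<xi> \<in> space M'. limit_path \<xi> \<in> K n}"
proof -
  have "limit_path \<xi> \<in> K n" if \<xi>: "(\<lambda>k. coord k (path \<xi>)) \<in> (\<lambda>z k. coord k z) ` K n" for \<xi>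
  proof -
    obtain z where z: "z \<in> K n" "\<iota> (path \<xi>) = \<iota> z" using \<xi> unfolding \<iota>_def by blast
    then show ?thesis using limit_path_eqI[of z \<xi>] K_subset_X by auto
  qed
  then have "measure M' {\<xi> \<in> space M'. (\<lambda>k. coord k (path \<xi>)) \<in> (\<lambda>z k. coord k z) ` K n}
    \<le> measure M' {\<xi> \<in> space M'. limit_path \<xi> \<in> K n}"
    by (intro M'.finite_measure_mono limit_path_event compactin_linf_closedin K(1)) auto
  then show ?thesis
    using limit_concentrated_K[of coord n, OF coord(1,2)] by linarith
qed

lemma coordinate_measurable: "f \<in> F \<Longrightarrow> (\<lambda>z. z f) \<in> borel_measurable (borel_linf F)"
  using linf_coord[of _ F _ f]
  by (intro continuous_map_borel_linf_measurable continuous_map_linf_Lipschitz[where L = 1]) simp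

lemma limit_path_coordinate_measurable: "f \<in> F \<Longrightarrow> (\<lambda>\<xi>. limit_path \<xi> f) \<in> borel_measurable M'"
  by (rule measurable_compose[OF limit_path_measurable coordinate_measurable])

text \<open>The separating set may be enlarged by any single index without changing the path that it
  determines.\<close>

lemma limit_path_version:
  assumes f: "f \<in> F"
  shows "AE \<xi> in M'. limit_path \<xi> f = H' f \<xi>"
proof -
  let ?A = "insert f separating"
  let ?E = "{\<xi> \<in> space M'. limit_path \<xi> f = H' f \<xi>}"
  have "countable ?A" "?A \<subseteq> F" using separating(1,2) f by auto
  from trig_coordinates[OF this] obtain g :: "nat \<Rightarrow> ('f \<Rightarrow> real) \<Rightarrow> real" where
    g: "\<forall>k. g k \<in> trig F" "\<forall>k z. \<bar>g k z\<bar> \<le> 1"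
      "\<forall>z z'. (\<forall>k. g k z = g k z') \<longleftrightarrow> (\<forall>f\<in>?A. z f = z' f)"
    by (elim exE conjE)
  have E: "?E \<in> sets M'"
    using limit_path_coordinate_measurable[OF f] H'_measurable[OF f] by measurable
  have "1 - inverse (real (Suc n)) \<le> measure M' ?E" for n
  proof -
    have "limit_path \<xi> f = H' f \<xi>" if \<xi>: "(\<lambda>k. g k (path \<xi>)) \<in> (\<lambda>z k. g k z) ` K n" for \<xi>
    proof -
      obtain z where z: "z \<in> K n" "(\<lambda>k. g k (path \<xi>)) = (\<lambda>k. g k z)" using \<xi> by blast
      have "\<forall>k. g k (path \<xi>) = g k z" using fun_cong[OF z(2)] by blast
      then have eq: "\<forall>f\<in>?A. path \<xi> f = z f"
        by (rule iffD1[OF spec[OF spec[OF g(3), of "path \<xi>"], of z]])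
      then have "\<iota> (path \<xi>) = \<iota> z" by (simp add: \<iota>_eq_iff)
      then have "limit_path \<xi> = z" using limit_path_eqI[of z \<xi>] z(1) K_subset_X by blast
      then show ?thesis using eq by simp
    qed
    then have "measure M' {\<xi> \<in> space M'. (\<lambda>k. g k (path \<xi>)) \<in> (\<lambda>z k. g k z) ` K n} \<le> measure M' ?E"
      by (intro M'.finite_measure_mono E) auto
    then show ?thesis
      using limit_concentrated_K[of g n] g(1,2) by (meson order_trans)
  qed
  then have "1 - measure M' ?E \<le> inverse (real (Suc n))" for n
    by (simp add: algebra_simps)
  then have "1 \<le> measure M' ?E"
    using LIMSEQ_le_const[OF LIMSEQ_inverse_real_of_nat, of "1 - measure M' ?E"] by auto
  then have "measure M' ?E = 1" using M'.prob_le_1[of ?E] by linarith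
  then show ?thesis using M'.AE_prob_1[of ?E] by auto
qed

lemma limit_path_version_finite:
  assumes "finite J" "J \<subseteq> F"
  shows "AE \<xi> in M'. \<forall>f\<in>J. limit_path \<xi> f = H' f \<xi>"
  using assms(2) limit_path_version by (intro AE_finite_allI assms(1)) auto

lemma lin_comb_cong: "(\<And>f. f \<in> snd ` set xs \<Longrightarrow> z f = z' f) \<Longrightarrow> lin_comb xs z = lin_comb xs z'"
  by (induction xs) auto

text \<open>Only finitely many coordinates enter \<open>g\<close>, and these agree simultaneously
  off one null set, which may depend on \<open>g\<close>.\<close>

lemma limit_path_trig:
  assumes "g \<in> trig F"
  shows "AE \<xi> in M'. g (limit_path \<xi>) = g (path \<xi>)"
  using assms
proof induction
  case (cos xs)
  have "AE \<xi> in M'. \<forall>f\<in>snd ` set xs. limit_path \<xi> f = H' f \<xi>"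
    by (rule limit_path_version_finite) (use cos in auto)
  then show ?case by eventually_elim (metis lin_comb_cong)
next
  case (sin xs)
  have "AE \<xi> in M'. \<forall>f\<in>snd ` set xs. limit_path \<xi> f = H' f \<xi>"
    by (rule limit_path_version_finite) (use sin in auto)
  then show ?case by eventually_elim (metis lin_comb_cong)
next
  case (add g h)
  from add.IH show ?case by eventually_elim simp
next
  case (scale g c)
  from scale.IH show ?case by eventually_elim simp
qed

lemma limit_path_integrable:
  assumes "continuous_map (mtopology_of (linf F)) euclideanreal h"
    and "\<And>z. z \<in> mspace (linf F) \<Longrightarrow> \<bar>h z\<bar> \<le> B"
  shows "integrable M' (\<lambda>\<xi>. h (limit_path \<xi>))"
proof (rule M'.integrable_const_bound[of _ B])
  show "(\<lambda>\<xi>. h (limit_path \<xi>)) \<in> borel_measurable M'"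
    by (rule measurable_compose[OF limit_path_measurable continuous_map_borel_linf_measurable[OF assms(1)]])
  show "AE \<xi> in M'. norm (h (limit_path \<xi>)) \<le> B"
    using assms(2) limit_path_in X_subset by (intro AE_I2) auto
qed

end

section \<open>Uniform convergence over bounded Lipschitz functions\<close>

context conditionally_convergent
begin

text \<open>The functions in \<open>BL1 F\<close> are approximated on a compact set by finitely many trigonometric ones,
  which are bounded by \<open>2\<close> everywhere, so that the error off the compact set is at most \<open>3\<close>.\<close>

lemma BL1_trig_net:
  assumes e: "0 < e" "e \<le> 1"
  obtains TT \<delta> where "finite TT" "TT \<subseteq> trig F" "\<delta> > 0"
    "\<forall>h\<in>BL1 F. \<exists>T\<in>TT. (\<forall>z\<in>mspace (linf F). \<bar>h z - T z\<bar> \<le> 4 * e + 3 * (1 - of_bool (z \<in> enlargement F (K n) \<delta>)))"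
proof -
  have KF: "K n \<subseteq> mspace (linf F)" by (rule compactin_linf_subset[OF K(1)])
  obtain H where H: "H \<subseteq> BL1 F" "finite H" "\<forall>h\<in>BL1 F. \<exists>h'\<in>H. \<forall>z\<in>K n. \<bar>h z - h' z\<bar> \<le> e"
    by (rule BL1_finite_net[OF K(1)[of n] e(1)])
  have inj: "inj_on (\<lambda>z k. coord k z) (K n)"
    using inj_on_subset[OF inj_on_\<iota> K_subset_X] unfolding \<iota>_def .
  have "\<forall>h\<in>H. \<exists>T. T \<in> trig F \<and> (\<forall>z\<in>K n. \<bar>T z - h z\<bar> \<le> e) \<and> (\<forall>z. \<bar>T z\<bar> \<le> 2)"
    using trig_approx_BL1[of F "K n" coord, OF K(1) coord(1,2) inj _ e] H(1) by blast
  from bchoice[OF this] obtain T where T: "\<forall>h\<in>H. T h \<in> trig F \<and> (\<forall>z\<in>K n. \<bar>T h z - h z\<bar> \<le> e) \<and> (\<forall>z. \<bar>T h z\<bar> \<le> 2)"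
    by (elim exE)
  have "\<forall>h\<in>H. \<exists>L\<ge>0. \<forall>z\<in>mspace (linf F). \<forall>z'\<in>mspace (linf F). \<bar>T h z - T h z'\<bar> \<le> L * mdist (linf F) z z'"
    using T trig_Lipschitz by blast
  from bchoice[OF this] obtain L where L: "\<forall>h\<in>H. 0 \<le> L h \<and> (\<forall>z\<in>mspace (linf F). \<forall>z'\<in>mspace (linf F).
      \<bar>T h z - T h z'\<bar> \<le> L h * mdist (linf F) z z')"
    by (elim exE)
  \<comment> \<open>One radius for all representatives: the added 1 gives
    \<open>\<delta> \<le> e\<close>, and the sum dominates each single Lipschitz constant.\<close>
  define \<delta> where "\<delta> = e / (1 + (\<Sum>h\<in>H. L h))"
  have S: "0 \<le> (\<Sum>h\<in>H. L h)" using L by (intro sum_nonneg) blast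
  have \<delta>: "\<delta> > 0" using S e(1) by (simp add: \<delta>_def)
  have \<delta>e: "\<delta> \<le> e" using S e(1) by (simp add: \<delta>_def field_simps)
  have L\<delta>: "L h * \<delta> \<le> e" if "h \<in> H" for h
  proof -
    have "L h \<le> (\<Sum>h\<in>H. L h)"
      using L by (intro member_le_sum that H(2)) blast
    then have "L h * e \<le> (1 + (\<Sum>h\<in>H. L h)) * e"
      using e(1) by (intro mult_right_mono) auto
    then show ?thesis using S by (simp add: \<delta>_def pos_divide_le_eq mult.commute)
  qed
  have approx: "\<exists>T\<in>T ` H. (\<forall>z\<in>mspace (linf F). \<bar>h z - T z\<bar> \<le> 4 * e + 3 * (1 - of_bool (z \<in> enlargement F (K n) \<delta>)))"
    if h: "h \<in> BL1 F" for h
  proof -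
    obtain h' where h': "h' \<in> H" "\<forall>z\<in>K n. \<bar>h z - h' z\<bar> \<le> e" using H(3) h by blast
    have T': "\<forall>z\<in>K n. \<bar>T h' z - h' z\<bar> \<le> e" "\<forall>z. \<bar>T h' z\<bar> \<le> 2" using T h'(1) by blast+
    have "\<bar>h z - T h' z\<bar> \<le> 4 * e + 3 * (1 - of_bool (z \<in> enlargement F (K n) \<delta>))"
      if z: "z \<in> mspace (linf F)" for z
    proof (cases "z \<in> enlargement F (K n) \<delta>")
      case True
      then obtain z' where z': "z' \<in> K n" "mdist (linf F) z z' < \<delta>"
        unfolding enlargement_def by blast
      have z'F: "z' \<in> mspace (linf F)" using z'(1) KF by blast
      have "\<bar>h z - h z'\<bar> \<le> e"
        using BL1_Lipschitz[OF h z z'F] z'(2) \<delta>e by linarith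
      moreover have "\<bar>T h' z - T h' z'\<bar> \<le> L h' * mdist (linf F) z z'"
        using L h'(1) z z'F by blast
      moreover have "L h' * mdist (linf F) z z' \<le> L h' * \<delta>"
        using L h'(1) z'(2) by (intro mult_left_mono) auto
      ultimately have "\<bar>h z - h z'\<bar> \<le> e" "\<bar>T h' z - T h' z'\<bar> \<le> e" using L\<delta>[OF h'(1)] by linarith+
      \<comment> \<open>One \<open>e\<close> each for moving from \<open>z\<close> to
        \<open>z'\<close> in \<open>h\<close> and in \<open>T h'\<close>, one for the net of
        \<open>BL1 F\<close>, one for the trigonometric approximation.\<close>
      then have "\<bar>h z - T h' z\<bar> \<le> 4 * e"
        using bspec[OF h'(2) z'(1)] bspec[OF T'(1) z'(1)] by linarith
      then show ?thesis using True by simp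
    next
      case False
      have "\<bar>h z - T h' z\<bar> \<le> 3"
        using BL1_bounds[OF h z] spec[OF T'(2), of z] by linarith
      then show ?thesis using False e(1) by simp
    qed
    then show ?thesis using h'(1) by (intro bexI[of _ "T h'"]) auto
  qed
  show thesis
  proof (rule that[of "T ` H" \<delta>])
    show "T ` H \<subseteq> trig F" using T by blast
  qed (use H(2) \<delta> approx in auto)
qed

text \<open>The bound \<open>V\<close> is formed from the finitely many approximants and the
  correction of (CAT). It is therefore measurable and free of \<open>h\<close>, although the
  supremum over \<open>BL1 F\<close> may be nonmeasurable.\<close>

lemma avg_BL1_uniform:
  assumes "\<epsilon> > 0"
  shows "\<exists>V :: nat \<Rightarrow> 'w \<Rightarrow> real. (\<forall>N\<ge>1. V N \<in> borel_measurable M) \<and> tendsto_mode m M V 0 \<and>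
    (\<forall>N\<ge>1. \<forall>\<omega>\<in>space M. \<forall>h\<in>BL1 F. \<bar>avg N h \<omega> - (\<integral>\<xi>. h (limit_path \<xi>) \<partial>M')\<bar> \<le> \<epsilon> + V N \<omega>)"
proof -
  \<comment> \<open>Replacing \<open>h\<close> by its approximant costs \<open>7 * e\<close> in the
    average and \<open>7 * e\<close> in the integral, whence 14; the net requires
    \<open>e \<le> 1\<close>.\<close>
  define e where "e = min 1 (\<epsilon> / 14)"
  have e: "0 < e" "e \<le> 1" "14 * e \<le> \<epsilon>" using assms by (auto simp: e_def min_def)
  obtain n where n: "inverse (real (Suc n)) < e" using reals_Archimedean[OF e(1)] by blast
  obtain TT \<delta> where TT: "finite TT" "TT \<subseteq> trig F" and \<delta>: "\<delta> > 0"
    and net: "\<forall>h\<in>BL1 F. \<exists>T\<in>TT. (\<forall>z\<in>mspace (linf F).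
      \<bar>h z - T z\<bar> \<le> 4 * e + 3 * (1 - of_bool (z \<in> enlargement F (K n) \<delta>)))"
    by (rule BL1_trig_net[OF e(1,2)])
  let ?U = "enlargement F (K n) \<delta>"
  obtain A where A: "\<forall>N\<ge>1. A N \<in> borel_measurable M" "tendsto_mode m M A (0::real)"
    "\<forall>N\<ge>1. \<forall>\<omega>\<in>space M. 1 - inverse (real (Suc n)) \<le> avg N (\<lambda>z. of_bool (z \<in> ?U)) \<omega> + A N \<omega>"
    using K(2)[of n, unfolded asymptotically_tight_in_def, rule_format, OF \<delta>] by (elim exE conjE)
  define c where "c T = (\<integral>\<xi>. T (path \<xi>) \<partial>M')" for T :: "('f \<Rightarrow> real) \<Rightarrow> real"
  define V where "V N \<omega> = (\<Sum>T\<in>TT. \<bar>avg N T \<omega> - c T\<bar>) + 3 * \<bar>A N \<omega>\<bar>" for N \<omega>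
  have "V N \<in> borel_measurable M" if "N \<ge> 1" for N
  proof -
    have "avg N T \<in> borel_measurable M" if "T \<in> TT" for T
      using avg_measurable[OF \<open>N \<ge> 1\<close>] that TT(2) by blast
    then show ?thesis
      unfolding V_def using A(1) that
      by (intro borel_measurable_add borel_measurable_sum borel_measurable_abs borel_measurable_diff
          borel_measurable_times borel_measurable_const) auto
  qed
  moreover have "tendsto_mode m M V 0"
  proof -
    have "tendsto_mode m M (\<lambda>N \<omega>. \<bar>avg N T \<omega> - c T\<bar>) 0" if "T \<in> TT" for T
      using that TT(2) unfolding c_def
      by (intro tendsto_mode_dominated[OF conv[of T], where B = 1]) (auto simp: dist_real_def)
    from tendsto_mode_sum[OF TT(1) this]
    have "tendsto_mode m M (\<lambda>N \<omega>. \<Sum>T\<in>TT. \<bar>avg N T \<omega> - c T\<bar>) 0" .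
    moreover have "tendsto_mode m M (\<lambda>N \<omega>. 3 * \<bar>A N \<omega>\<bar>) 0"
      by (rule tendsto_mode_dominated[OF A(2), where B = 3]) (auto simp: dist_real_def)
    ultimately show ?thesis
      using tendsto_mode_add unfolding V_def by fastforce
  qed
  moreover have "\<bar>avg N h \<omega> - (\<integral>\<xi>. h (limit_path \<xi>) \<partial>M')\<bar> \<le> \<epsilon> + V N \<omega>"
    if N: "N \<ge> 1" "\<omega> \<in> space M" and h: "h \<in> BL1 F" for N \<omega> h
  proof -
    obtain T where T: "T \<in> TT" and hT: "\<forall>z\<in>mspace (linf F).
        \<bar>h z - T z\<bar> \<le> 4 * e + 3 * (1 - of_bool (z \<in> ?U))"
      using bspec[OF net h] by (elim bexE)
    have Tt: "T \<in> trig F" using T TT(2) by blast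
    define P where "P = avg N (\<lambda>z. of_bool (z \<in> ?U)) \<omega>"
    have arith: "x \<le> 4 * e + 3 * y \<Longrightarrow> y \<le> e + z \<Longrightarrow> x \<le> 7 * e + 3 * z" for x y z :: real
      by linarith
    have "\<bar>avg N h \<omega> - avg N T \<omega>\<bar> \<le> 4 * e + 3 * (1 - P)"
      unfolding P_def by (rule avg_diff_le[OF N]) (rule bspec[OF hT])
    moreover have "1 - P \<le> e + \<bar>A N \<omega>\<bar>"
      using A(3)[rule_format, OF N, folded P_def] n abs_ge_self[of "A N \<omega>"] by linarith
    ultimately have 1: "\<bar>avg N h \<omega> - avg N T \<omega>\<bar> \<le> 7 * e + 3 * \<bar>A N \<omega>\<bar>" by (rule arith)
    have 2: "\<bar>avg N T \<omega> - c T\<bar> \<le> (\<Sum>T\<in>TT. \<bar>avg N T \<omega> - c T\<bar>)"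
      by (rule member_le_sum[OF T, of "\<lambda>T. \<bar>avg N T \<omega> - c T\<bar>"]) (simp_all add: TT(1))
    \<comment> \<open>(CWCM) expresses the limit by the original process; only after the passage to
      the version can it be compared with the integral of \<open>h\<close>.\<close>
    have "c T = (\<integral>\<xi>. T (limit_path \<xi>) \<partial>M')"
      unfolding c_def
    proof (rule integral_cong_AE)
      show "(\<lambda>\<xi>. T (limit_path \<xi>)) \<in> borel_measurable M'"
        by (rule measurable_compose[OF limit_path_measurable
              continuous_map_borel_linf_measurable[OF continuous_map_trig[OF Tt]]])
      show "AE \<xi> in M'. T (path \<xi>) = T (limit_path \<xi>)"
        using limit_path_trig[OF Tt] by eventually_elim simp
    qed (rule trig_path_measurable[OF Tt])
    moreover have "\<bar>(\<integral>\<xi>. h (limit_path \<xi>) \<partial>M') - (\<integral>\<xi>. T (limit_path \<xi>) \<partial>M')\<bar> \<le> 7 * e"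
    proof -
      \<comment> \<open>On this event the path lies in the enlargement as well, since \<delta> is
        positive; its probability exceeds \<open>1 - e\<close>.\<close>
      let ?E = "{\<xi> \<in> space M'. limit_path \<xi> \<in> K n}"
      have E: "?E \<in> sets M'"
        by (rule limit_path_event[OF compactin_linf_closedin[OF K(1)]])
      have hi: "integrable M' (\<lambda>\<xi>. h (limit_path \<xi>))"
        by (rule limit_path_integrable[OF continuous_map_BL1[OF h], of 1]) (use BL1_bounds[OF h] in auto)
      obtain B where B: "\<And>z. \<bar>T z\<bar> \<le> B" using trig_bounded[OF Tt] by blast
      have Ti: "integrable M' (\<lambda>\<xi>. T (limit_path \<xi>))"
        by (rule limit_path_integrable[OF continuous_map_trig[OF Tt], of B]) (rule B)
      have Ei: "integrable M' (\<lambda>\<xi>. 4 * e + 3 * (1 - indicator ?E \<xi>))"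
        using E by (intro Bochner_Integration.integrable_add Bochner_Integration.integrable_diff
            integrable_mult_right M'.integrable_const) (simp add: less_top[symmetric])
      have "\<bar>(\<integral>\<xi>. h (limit_path \<xi>) \<partial>M') - (\<integral>\<xi>. T (limit_path \<xi>) \<partial>M')\<bar>
          = \<bar>\<integral>\<xi>. h (limit_path \<xi>) - T (limit_path \<xi>) \<partial>M'\<bar>"
        by (simp only: Bochner_Integration.integral_diff[OF hi Ti])
      also have "\<dots> \<le> (\<integral>\<xi>. \<bar>h (limit_path \<xi>) - T (limit_path \<xi>)\<bar> \<partial>M')"
        by (rule integral_abs_bound)
      also have "\<dots> \<le> (\<integral>\<xi>. 4 * e + 3 * (1 - indicator ?E \<xi>) \<partial>M')"
      proof (rule integral_mono[OF _ Ei])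
        show "integrable M' (\<lambda>\<xi>. \<bar>h (limit_path \<xi>) - T (limit_path \<xi>)\<bar>)"
          by (intro integrable_abs Bochner_Integration.integrable_diff hi Ti)
        fix \<xi> assume \<xi>: "\<xi> \<in> space M'"
        have lF: "limit_path \<xi> \<in> mspace (linf F)" using limit_path_in X_subset by blast
        have "mdist (linf F) (limit_path \<xi>) (limit_path \<xi>) = 0"
          using Metric_space.zero[OF Metric_space_linf lF lF] by blast
        then have "mdist (linf F) (limit_path \<xi>) (limit_path \<xi>) < \<delta>" using \<delta> by linarith
        then have "limit_path \<xi> \<in> K n \<Longrightarrow> limit_path \<xi> \<in> ?U"
          using lF unfolding enlargement_def by blast
        then have le: "(1::real) - of_bool (limit_path \<xi> \<in> ?U) \<le> 1 - indicator ?E \<xi>"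
          using \<xi> by (auto simp: indicator_def)
        show "\<bar>h (limit_path \<xi>) - T (limit_path \<xi>)\<bar> \<le> 4 * e + 3 * (1 - indicator ?E \<xi>)"
          by (rule order_trans[OF bspec[OF hT lF]]) (intro add_left_mono mult_left_mono le, simp)
      qed
      also have "\<dots> = 4 * e + 3 * (1 - measure M' ?E)"
        using E by (simp add: M'.prob_space less_top[symmetric])
      also have "\<dots> \<le> 7 * e"
      proof -
        have "4 * e + 3 * (1 - x) \<le> 7 * e" if "1 - y \<le> x" "y < e" for x y :: real
          using that by (simp add: algebra_simps)
        from this[OF limit_path_tight[of n] n] show ?thesis .
      qed
      finally show ?thesis .
    qed
    ultimately show ?thesis
      using 1 2 e(3) unfolding V_def by linarith
  qed
  ultimately show ?thesis by (intro exI[of _ V]) simp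
qed

lemma uniform_convergence:
  "\<exists>(Q :: ('f \<Rightarrow> real) measure) (G :: ('f \<Rightarrow> real) \<Rightarrow> 'f \<Rightarrow> real).
     prob_space Q \<and> G \<in> Q \<rightarrow>\<^sub>M borel_linf F \<and> tight_map F Q G \<and>
     same_fdd F Q (\<lambda>f \<omega>. G \<omega> f) M' H' \<and>
     tendsto_outer_mode m M (\<lambda>N \<omega>. SUP h\<in>BL1 F. \<bar>avg N h \<omega> - (\<integral>\<xi>. h (G \<xi>) \<partial>Q)\<bar>) 0"
proof (intro exI conjI)
  \<comment> \<open>The canonical realization: the law of the limiting path on the space of bounded
    functions, with the identity as mapping.\<close>
  let ?Q = "distr M' (borel_linf F) limit_path"
  let ?G = "\<lambda>z :: 'f \<Rightarrow> real. z"
  show "prob_space ?Q" by (rule M'.prob_space_distr[OF limit_path_measurable])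
  show "?G \<in> ?Q \<rightarrow>\<^sub>M borel_linf F" by simp
  show "tight_map F ?Q ?G"
    unfolding tight_map_def
  proof (intro allI impI)
    fix \<epsilon> :: real assume "\<epsilon> > 0"
    then obtain n where n: "inverse (real (Suc n)) < \<epsilon>" using reals_Archimedean by blast
    have "{\<omega> \<in> space ?Q. ?G \<omega> \<in> K n} = K n"
      using compactin_linf_subset[OF K(1)[of n]] by auto
    moreover have "measure ?Q (K n) = measure M' (limit_path -` K n \<inter> space M')"
      by (rule measure_distr[OF limit_path_measurable closedin_borel_linf[OF compactin_linf_closedin[OF K(1)]]])
    moreover have "limit_path -` K n \<inter> space M' = {\<xi> \<in> space M'. limit_path \<xi> \<in> K n}" by auto
    ultimately have "1 - \<epsilon> \<le> measure ?Q {\<omega> \<in> space ?Q. ?G \<omega> \<in> K n}"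
      using limit_path_tight[of n] n by simp
    then show "\<exists>K. compactin (mtopology_of (linf F)) K \<and> 1 - \<epsilon> \<le> measure ?Q {\<omega> \<in> space ?Q. ?G \<omega> \<in> K}"
      using K(1)[of n] by (intro exI[of _ "K n"] conjI)
  qed
  show "same_fdd F ?Q (\<lambda>f \<omega>. ?G \<omega> f) M' H'"
    unfolding same_fdd_def
  proof (intro allI impI, elim conjE)
    fix J assume J: "finite J" "J \<subseteq> F"
    have meas: "(\<lambda>z. \<lambda>f\<in>J. z f) \<in> borel_linf F \<rightarrow>\<^sub>M PiM J (\<lambda>_. borel :: real measure)"
      using J(2) by (intro measurable_restrict coordinate_measurable) auto
    have "distr ?Q (PiM J (\<lambda>_. borel)) (\<lambda>z. \<lambda>f\<in>J. z f) =
        distr M' (PiM J (\<lambda>_. borel)) (\<lambda>\<xi>. \<lambda>f\<in>J. limit_path \<xi> f)"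
      by (simp add: distr_distr[OF meas limit_path_measurable] comp_def)
    also have "\<dots> = distr M' (PiM J (\<lambda>_. borel)) (\<lambda>\<xi>. \<lambda>f\<in>J. H' f \<xi>)"
    proof (rule distr_cong_AE)
      show "AE \<xi> in M'. (\<lambda>f\<in>J. limit_path \<xi> f) = (\<lambda>f\<in>J. H' f \<xi>)"
        using limit_path_version_finite[OF J] by eventually_elim (rule restrict_ext, blast)
      show "(\<lambda>\<xi>. \<lambda>f\<in>J. limit_path \<xi> f) \<in> M' \<rightarrow>\<^sub>M PiM J (\<lambda>_. borel)"
        using J(2) by (intro measurable_restrict limit_path_coordinate_measurable) auto
      show "(\<lambda>\<xi>. \<lambda>f\<in>J. H' f \<xi>) \<in> M' \<rightarrow>\<^sub>M PiM J (\<lambda>_. borel)"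
        using J(2) by (intro measurable_restrict H'_measurable) auto
    qed simp_all
    finally show "distr ?Q (PiM J (\<lambda>_. borel)) (\<lambda>\<omega>. \<lambda>f\<in>J. ?G \<omega> f) =
        distr M' (PiM J (\<lambda>_. borel)) (\<lambda>\<omega>. \<lambda>f\<in>J. H' f \<omega>)" .
  qed
  have int: "(\<integral>\<xi>. h (?G \<xi>) \<partial>?Q) = (\<integral>\<xi>. h (limit_path \<xi>) \<partial>M')" if "h \<in> BL1 F" for h
    by (rule integral_distr[OF limit_path_measurable
          continuous_map_borel_linf_measurable[OF continuous_map_BL1[OF that]]])
  have ne: "BL1 F \<noteq> {}"
  proof -
    have "(\<lambda>z. 0) \<in> BL1 F" by (simp add: BL1_def linf_dist_nonneg)
    then show ?thesis by blast
  qed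
  show "tendsto_outer_mode m M (\<lambda>N \<omega>. SUP h\<in>BL1 F. \<bar>avg N h \<omega> - (\<integral>\<xi>. h (?G \<xi>) \<partial>?Q)\<bar>) 0"
  proof (rule tendsto_outer_modeI)
    fix \<epsilon> :: real assume "\<epsilon> > 0"
    from avg_BL1_uniform[OF this] obtain V :: "nat \<Rightarrow> 'w \<Rightarrow> real" where V: "\<forall>N\<ge>1. V N \<in> borel_measurable M" "tendsto_mode m M V 0"
      "\<forall>N\<ge>1. \<forall>\<omega>\<in>space M. \<forall>h\<in>BL1 F. \<bar>avg N h \<omega> - (\<integral>\<xi>. h (limit_path \<xi>) \<partial>M')\<bar> \<le> \<epsilon> + V N \<omega>"
      by (elim exE conjE)
    have "dist (SUP h\<in>BL1 F. \<bar>avg N h \<omega> - (\<integral>\<xi>. h (?G \<xi>) \<partial>?Q)\<bar>) 0 \<le> \<epsilon> + V N \<omega>"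
      if N: "N \<ge> 1" "\<omega> \<in> space M" for N \<omega>
    proof -
      let ?a = "\<lambda>h. \<bar>avg N h \<omega> - (\<integral>\<xi>. h (?G \<xi>) \<partial>?Q)\<bar>"
      have le: "?a h \<le> \<epsilon> + V N \<omega>" if "h \<in> BL1 F" for h
        using V(3) N that unfolding int[OF that] by blast
      \<comment> \<open>A real supremum is meaningful only for a nonempty family bounded above; the
        zero function and the uniform bound provide this.\<close>
      obtain h0 where h0: "h0 \<in> BL1 F" using ne by blast
      have "0 \<le> ?a h0" by simp
      also have "\<dots> \<le> (SUP h\<in>BL1 F. ?a h)"
        by (rule cSUP_upper[OF h0 bdd_aboveI2]) (rule le)
      finally have "0 \<le> (SUP h\<in>BL1 F. ?a h)" .
      moreover have "(SUP h\<in>BL1 F. ?a h) \<le> \<epsilon> + V N \<omega>"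
        by (rule cSUP_least[OF ne le])
      ultimately show ?thesis by (simp add: dist_real_def)
    qed
    then show "\<exists>V. (\<forall>N\<ge>1. V N \<in> borel_measurable M) \<and> tendsto_mode m M V (0::real) \<and>
        (\<forall>N\<ge>1. \<forall>\<omega>\<in>space M. dist (SUP h\<in>BL1 F. \<bar>avg N h \<omega> - (\<integral>\<xi>. h (?G \<xi>) \<partial>?Q)\<bar>) 0 \<le> \<epsilon> + V N \<omega>)"
      using V(1,2) by (intro exI[of _ V]) simp
  qed
qed

end

section \<open>Sampling designs\<close>

text \<open>Nonnegativity makes the cumulative sums increase, so the half-open intervals between
  successive sums are disjoint; the first has no lower end, as in \<open>select\<close>.\<close>

lemma cumulative_index_unique:
  fixes q :: "nat \<Rightarrow> real"
  assumes q: "\<And>j. j \<in> {1..n} \<Longrightarrow> 0 \<le> q j" and i: "i \<in> {1..n}" and k: "k \<in> {1..n}"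
    and ui: "i = 1 \<or> sum q {1..<i} < u" "u \<le> sum q {1..i}"
    and uk: "k = 1 \<or> sum q {1..<k} < u" "u \<le> sum q {1..k}"
  shows "k = i"
proof -
  have *: False if "j < l" "l \<in> {1..n}" "j \<in> {1..n}" "l = 1 \<or> sum q {1..<l} < u" "u \<le> sum q {1..j}" for j l
  proof -
    have "sum q {1..j} \<le> sum q {1..<l}"
      using that(1,2) q by (intro sum_mono2) auto
    moreover have "l \<noteq> 1" using that(1,3) by simp
    ultimately show False using that(4,5) by simp
  qed
  show ?thesis
    using *[of k i] *[of i k] i k ui uk by (metis linorder_neqE_nat)
qed

text \<open>The witness is the least index whose cumulative sum reaches \<open>u\<close>; positivity
  of \<open>u\<close> rules out the empty sum.\<close>

lemma cumulative_index_exists: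
  fixes q :: "nat \<Rightarrow> real"
  assumes "0 < u" "u \<le> sum q {1..n}"
  shows "\<exists>i\<in>{1..n}. sum q {1..<i} < u \<and> u \<le> sum q {1..i}"
proof -
  define i where "i = (LEAST i. u \<le> sum q {1..i})"
  have i: "u \<le> sum q {1..i}" "i \<le> n"
    unfolding i_def using assms(2) by (rule LeastI, rule Least_le)
  have "i \<noteq> 0"
  proof
    assume "i = 0"
    then show False using i(1) assms(1) by simp
  qed
  then have "\<not> u \<le> sum q {1..i - 1}"
    unfolding i_def by (intro not_less_Least) simp
  moreover have "{1..<i} = {1..i - 1}" using \<open>i \<noteq> 0\<close> by auto
  ultimately show ?thesis using i \<open>i \<noteq> 0\<close> by (intro bexI[of _ i]) auto
qed

lemma select_eq:
  assumes q: "\<And>j. j \<in> {1..2 ^ N} \<Longrightarrow> 0 \<le> p N (e N j) x" and i: "i \<in> {1..2 ^ N}"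
    and u: "(\<Sum>j\<in>{1..<i}. p N (e N j) x) < u" "u \<le> (\<Sum>j\<in>{1..i}. p N (e N j) x)"
  shows "select p e N x u = e N i"
  unfolding select_def
proof (rule the_equality)
  show "\<exists>k\<in>{1..2 ^ N}. e N i = e N k \<and> (k = 1 \<or> (\<Sum>j\<in>{1..<k}. p N (e N j) x) < u) \<and>
      u \<le> (\<Sum>j\<in>{1..k}. p N (e N j) x)"
    using i u by (intro bexI[of _ i]) auto
next
  fix s assume "\<exists>k\<in>{1..2 ^ N}. s = e N k \<and> (k = 1 \<or> (\<Sum>j\<in>{1..<k}. p N (e N j) x) < u) \<and>
      u \<le> (\<Sum>j\<in>{1..k}. p N (e N j) x)"
  then obtain k where k: "k \<in> {1..2 ^ N}" "s = e N k" "k = 1 \<or> (\<Sum>j\<in>{1..<k}. p N (e N j) x) < u"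
    "u \<le> (\<Sum>j\<in>{1..k}. p N (e N j) x)" by blast
  have "k = i"
    by (rule cumulative_index_unique[of "2 ^ N" "\<lambda>j. p N (e N j) x" i k u, OF q i k(1) disjI2[OF u(1)] u(2) k(3,4)])
  then show "s = e N i" using k(2) by simp
qed

lemma uniform_prob_interval:
  assumes D: "D \<in> borel_measurable Pd" and distr: "distr Pd borel D = uniform_measure lborel {0..1::real}"
    and ab: "0 \<le> a" "a \<le> b" "b \<le> 1"
  shows "measure Pd {d \<in> space Pd. D d \<in> {a<..b}} = b - a"
proof -
  have "measure Pd {d \<in> space Pd. D d \<in> {a<..b}} = measure (distr Pd borel D) {a<..b}"
    using D by (simp add: measure_distr vimage_def Int_def conj_commute)
  also have "\<dots> = measure lborel ({0..1} \<inter> {a<..b}) / measure lborel {0..1::real}"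
    unfolding distr by (rule measure_uniform_measure) auto
  also have "{0..1} \<inter> {a<..b} = {a<..b}" using ab by auto
  finally show ?thesis using ab(2) by simp
qed

locale sampling =
  fixes MY :: "'y measure" and MX :: "'x measure"
    and Pyx :: "('y \<times> 'x) measure" and Pd :: "'d measure" and D :: "'d \<Rightarrow> real"
    and p :: "nat \<Rightarrow> (nat \<Rightarrow> nat) \<Rightarrow> (nat \<Rightarrow> 'x) \<Rightarrow> real"
    and e :: "nat \<Rightarrow> nat \<Rightarrow> nat \<Rightarrow> nat"
  assumes Pyx: "prob_space Pyx" "sets Pyx = sets (MY \<Otimes>\<^sub>M MX)"
    and Pd: "prob_space Pd"
    and D: "D \<in> borel_measurable Pd" "distr Pd borel D = uniform_measure lborel {0..1}"
    and design: "sampling_design MX p"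
    and enum: "\<And>N. N \<ge> 1 \<Longrightarrow> bij_betw (e N) {1..2 ^ N} (bin_vecs N)"
begin

abbreviation M :: "((nat \<Rightarrow> 'y \<times> 'x) \<times> 'd) measure" where
  "M \<equiv> sample_space Pyx Pd"

lemma prob_space_M: "prob_space M"
  unfolding sample_space_def by (intro prob_space_pair prob_space_PiM Pyx(1) Pd)

lemma space_M: "\<omega> \<in> space M \<longleftrightarrow> fst \<omega> \<in> space (PiM {1..} (\<lambda>_. Pyx)) \<and> snd \<omega> \<in> space Pd"
  by (cases \<omega>) (simp add: sample_space_def space_pair_measure)

lemma Xvec_space:
  assumes "\<omega> \<in> space M"
  shows "Xvec N \<omega> \<in> space (PiM {1..N} (\<lambda>_. MX))"
proof -
  have "space Pyx = space MY \<times> space MX"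
    using sets_eq_imp_space_eq[OF Pyx(2)] by (simp add: space_pair_measure)
  then have "snd (fst \<omega> i) \<in> space MX" if "i \<in> {1..N}" for i
    using assms that unfolding space_M space_PiM by (auto simp: PiE_iff mem_Times_iff)
  then show ?thesis by (simp add: Xvec_def space_PiM)
qed

lemma design_nonneg: "N \<ge> 1 \<Longrightarrow> \<omega> \<in> space M \<Longrightarrow> s \<in> bin_vecs N \<Longrightarrow> 0 \<le> p N s (Xvec N \<omega>)"
  and design_sum: "N \<ge> 1 \<Longrightarrow> \<omega> \<in> space M \<Longrightarrow> (\<Sum>s\<in>bin_vecs N. p N s (Xvec N \<omega>)) = 1"
  using design Xvec_space[of \<omega> N] unfolding sampling_design_def by blast+

lemma enum_in: "N \<ge> 1 \<Longrightarrow> j \<in> {1..2 ^ N} \<Longrightarrow> e N j \<in> bin_vecs N"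
  using bij_betwE[OF enum] by blast

lemma enum_sum: "N \<ge> 1 \<Longrightarrow> (\<Sum>j\<in>{1..2 ^ N}. f (e N j)) = (\<Sum>s\<in>bin_vecs N. f s)"
  by (rule sum.reindex_bij_betw[OF enum])

lemma cumulative_bounds:
  assumes N: "N \<ge> 1" "\<omega> \<in> space M" and i: "i \<in> {1..2 ^ N}"
  shows "0 \<le> (\<Sum>j\<in>{1..<i}. p N (e N j) (Xvec N \<omega>))"
    and "(\<Sum>j\<in>{1..i}. p N (e N j) (Xvec N \<omega>)) = (\<Sum>j\<in>{1..<i}. p N (e N j) (Xvec N \<omega>)) + p N (e N i) (Xvec N \<omega>)"
    and "(\<Sum>j\<in>{1..i}. p N (e N j) (Xvec N \<omega>)) \<le> 1"
proof -
  have q: "0 \<le> p N (e N j) (Xvec N \<omega>)" if "j \<in> {1..2 ^ N}" for j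
    by (rule design_nonneg[OF N enum_in[OF N(1) that]])
  show "0 \<le> (\<Sum>j\<in>{1..<i}. p N (e N j) (Xvec N \<omega>))"
    using i by (intro sum_nonneg q) auto
  have "{1..i} = insert i {1..<i}" using i by auto
  then show "(\<Sum>j\<in>{1..i}. p N (e N j) (Xvec N \<omega>)) = (\<Sum>j\<in>{1..<i}. p N (e N j) (Xvec N \<omega>)) + p N (e N i) (Xvec N \<omega>)"
    by simp
  have "(\<Sum>j\<in>{1..i}. p N (e N j) (Xvec N \<omega>)) \<le> (\<Sum>j\<in>{1..2 ^ N}. p N (e N j) (Xvec N \<omega>))"
    using i by (intro sum_mono2 q) auto
  then show "(\<Sum>j\<in>{1..i}. p N (e N j) (Xvec N \<omega>)) \<le> 1"
    using enum_sum[OF N(1), of "\<lambda>s. p N s (Xvec N \<omega>)"] design_sum[OF N] by simp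
qed

lemma select_event_prob:
  assumes N: "N \<ge> 1" "\<omega> \<in> space M" and i: "i \<in> {1..2 ^ N}"
  shows "measure Pd {d \<in> space Pd. D d \<in>
      {(\<Sum>j\<in>{1..<i}. p N (e N j) (Xvec N \<omega>))<..(\<Sum>j\<in>{1..i}. p N (e N j) (Xvec N \<omega>))}} = p N (e N i) (Xvec N \<omega>)"
  using uniform_prob_interval[OF D cumulative_bounds(1)[OF N i] _ cumulative_bounds(3)[OF N i]]
    cumulative_bounds(2)[OF N i] design_nonneg[OF N enum_in[OF N(1) i]] by simp

lemma Svec_eq:
  assumes N: "N \<ge> 1" "\<omega> \<in> space M" and i: "i \<in> {1..2 ^ N}"
    and d: "D d \<in> {(\<Sum>j\<in>{1..<i}. p N (e N j) (Xvec N \<omega>))<..(\<Sum>j\<in>{1..i}. p N (e N j) (Xvec N \<omega>))}"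
  shows "Svec p e D N (fst \<omega>, d) = e N i"
proof -
  have "Xvec N (fst \<omega>, d) = Xvec N \<omega>" by (simp add: Xvec_def)
  moreover have "select p e N (Xvec N \<omega>) (D d) = e N i"
    using d i by (intro select_eq design_nonneg[OF N] enum_in[OF N(1)]) auto
  ultimately show ?thesis by (simp add: Svec_def)
qed

text \<open>The selection event has positive probability under the uniform variable and so is
  nonempty. Facts about the processes at sample points reach their representing functions through
  such points.\<close>

lemma Svec_attained:
  assumes N: "N \<ge> 1" "\<omega> \<in> space M" and s: "s \<in> bin_vecs N" "p N s (Xvec N \<omega>) \<noteq> 0"
  shows "\<exists>d\<in>space Pd. Svec p e D N (fst \<omega>, d) = s"
proof -
  have "s \<in> e N ` {1..2 ^ N}" using s(1) bij_betw_imp_surj_on[OF enum[OF N(1)]] by simp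
  then obtain i where i: "i \<in> {1..2 ^ N}" "s = e N i" by blast
  let ?E = "{d \<in> space Pd. D d \<in>
      {(\<Sum>j\<in>{1..<i}. p N (e N j) (Xvec N \<omega>))<..(\<Sum>j\<in>{1..i}. p N (e N j) (Xvec N \<omega>))}}"
  have "measure Pd ?E \<noteq> 0" using select_event_prob[OF N i(1)] s(2) i(2) by simp
  then have "?E \<noteq> {}" using measure_empty[of Pd] by metis
  then obtain d where "d \<in> ?E" by blast
  then show ?thesis using Svec_eq[OF N i(1), of d] i(2) by blast
qed

text \<open>With the data held fixed, the selection intervals partition the randomisation space up
  to the null event that \<open>D\<close> misses (0, 1]; on each piece the selected vector is
  constant, and the probability of the piece is the interval length.\<close>

lemma Svec_expectation:
  fixes g :: "(nat \<Rightarrow> nat) \<Rightarrow> real"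
  assumes N: "N \<ge> 1" "\<omega> \<in> space M"
    and g: "(\<lambda>d. g (Svec p e D N (fst \<omega>, d))) \<in> borel_measurable Pd"
  shows "(\<integral>d. g (Svec p e D N (fst \<omega>, d)) \<partial>Pd) = (\<Sum>s\<in>bin_vecs N. p N s (Xvec N \<omega>) * g s)"
proof -
  interpret Pd: prob_space Pd by (rule Pd)
  let ?q = "\<lambda>j. p N (e N j) (Xvec N \<omega>)"
  let ?J = "\<lambda>i. {sum ?q {1..<i}<..sum ?q {1..i}}"
  let ?E = "\<lambda>i. {d \<in> space Pd. D d \<in> ?J i}"
  have E: "?E i \<in> sets Pd" for i
    using D(1) by measurable
  have q: "0 \<le> ?q j" if "j \<in> {1..2 ^ N}" for j
    by (rule design_nonneg[OF N enum_in[OF N(1) that]])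
  have total: "sum ?q {1..2 ^ N} = 1"
    using enum_sum[OF N(1), of "\<lambda>s. p N s (Xvec N \<omega>)"] design_sum[OF N] by simp
  \<comment> \<open>Positive values of \<open>D\<close> remove the exceptional role of the first
    interval.\<close>
  have "measure Pd {d \<in> space Pd. D d \<in> {0<..1}} = 1"
    using uniform_prob_interval[OF D, of 0 1] by simp
  from Pd.AE_prob_1[OF this] have "AE d in Pd. D d \<in> {0<..1}" by eventually_elim simp
  then have AE: "AE d in Pd. g (Svec p e D N (fst \<omega>, d)) = (\<Sum>i\<in>{1..2 ^ N}. indicator (?E i) d * g (e N i))"
  proof (rule AE_mp, intro AE_I2 impI)
    fix d assume d: "d \<in> space Pd" "D d \<in> {0<..1}"
    have "0 < D d" "D d \<le> sum ?q {1..2 ^ N}" using d(2) total by auto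
    from cumulative_index_exists[OF this] obtain i where i: "i \<in> {1..2 ^ N}" "D d \<in> ?J i" by auto
    have "d \<notin> ?E k" if k: "k \<in> {1..2 ^ N}" "k \<noteq> i" for k
    proof
      assume "d \<in> ?E k"
      then have "sum ?q {1..<k} < D d" "D d \<le> sum ?q {1..k}" by auto
      moreover have "sum ?q {1..<i} < D d" "D d \<le> sum ?q {1..i}" using i(2) by auto
      ultimately show False
        using cumulative_index_unique[of "2 ^ N" ?q i k "D d"] q i(1) k by blast
    qed
    then have "(\<Sum>k\<in>{1..2 ^ N}. indicator (?E k) d * g (e N k)) =
        (\<Sum>k\<in>{1..2 ^ N}. if k = i then g (e N i) else 0)"
      using d(1) i(2) by (intro sum.cong refl) (auto simp: indicator_def)
    also have "\<dots> = g (e N i)" using i(1) by simp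
    also have "\<dots> = g (Svec p e D N (fst \<omega>, d))" using Svec_eq[OF N i] by simp
    finally show "g (Svec p e D N (fst \<omega>, d)) = (\<Sum>k\<in>{1..2 ^ N}. indicator (?E k) d * g (e N k))" ..
  qed
  have "(\<integral>d. g (Svec p e D N (fst \<omega>, d)) \<partial>Pd) = (\<integral>d. (\<Sum>i\<in>{1..2 ^ N}. indicator (?E i) d * g (e N i)) \<partial>Pd)"
  proof (rule integral_cong_AE[OF g _ AE])
    show "(\<lambda>d. \<Sum>i\<in>{1..2 ^ N}. indicator (?E i) d * g (e N i)) \<in> borel_measurable Pd"
      by (intro borel_measurable_sum borel_measurable_times borel_measurable_const borel_measurable_indicator E)
  qed
  also have "\<dots> = (\<Sum>i\<in>{1..2 ^ N}. \<integral>d. indicator (?E i) d * g (e N i) \<partial>Pd)"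
  proof (rule Bochner_Integration.integral_sum)
    show "integrable Pd (\<lambda>d. indicator (?E i) d * g (e N i))" for i
      by (intro integrable_mult_left integrable_real_indicator E) (simp add: less_top[symmetric])
  qed
  also have "\<dots> = (\<Sum>i\<in>{1..2 ^ N}. ?q i * g (e N i))"
    using E select_event_prob[OF N] by (intro sum.cong refl) simp
  also have "\<dots> = (\<Sum>s\<in>bin_vecs N. p N s (Xvec N \<omega>) * g s)"
    by (rule enum_sum[OF N(1), of "\<lambda>s. p N s (Xvec N \<omega>) * g s"])
  finally show ?thesis .
qed

text \<open>A design expectation is an integral over the randomisation space alone, hence measurable by
  Fubini's theorem.\<close>

lemma design_expectation_measurable:
  fixes g :: "(nat \<Rightarrow> nat) \<Rightarrow> (nat \<Rightarrow> 'y) \<Rightarrow> (nat \<Rightarrow> 'x) \<Rightarrow> real"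
  assumes N: "N \<ge> 1"
    and g: "(\<lambda>\<omega>. g (Svec p e D N \<omega>) (Yvec N \<omega>) (Xvec N \<omega>)) \<in> borel_measurable M"
  shows "(\<lambda>\<omega>. \<Sum>s\<in>bin_vecs N. p N s (Xvec N \<omega>) * g s (Yvec N \<omega>) (Xvec N \<omega>)) \<in> borel_measurable M"
proof -
  interpret Pd: prob_space Pd by (rule Pd)
  let ?G = "\<lambda>\<omega>. g (Svec p e D N \<omega>) (Yvec N \<omega>) (Xvec N \<omega>)"
  have G: "(\<lambda>(v, d). ?G (v, d)) \<in> borel_measurable (PiM {1..} (\<lambda>_. Pyx) \<Otimes>\<^sub>M Pd)"
    using g unfolding sample_space_def by simp
  have int: "(\<lambda>v. \<integral>d. ?G (v, d) \<partial>Pd) \<in> borel_measurable (PiM {1..} (\<lambda>_. Pyx))"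
    by (rule Pd.borel_measurable_lebesgue_integral[OF G])
  have fubini: "(\<lambda>\<omega>. \<integral>d. ?G (fst \<omega>, d) \<partial>Pd) \<in> borel_measurable M"
    unfolding sample_space_def by (rule measurable_compose[OF measurable_fst int])
  have "(\<integral>d. ?G (fst \<omega>, d) \<partial>Pd) = (\<Sum>s\<in>bin_vecs N. p N s (Xvec N \<omega>) * g s (Yvec N \<omega>) (Xvec N \<omega>))"
    if \<omega>: "\<omega> \<in> space M" for \<omega>
  proof -
    have YX: "Xvec N (fst \<omega>, d) = Xvec N \<omega>" "Yvec N (fst \<omega>, d) = Yvec N \<omega>" for d
      by (simp_all add: Xvec_def Yvec_def)
    have "fst \<omega> \<in> space (PiM {1..} (\<lambda>_. Pyx))" using \<omega> by (simp add: space_M)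
    from measurable_Pair2[OF G this]
    have "(\<lambda>d. ?G (fst \<omega>, d)) \<in> borel_measurable Pd" by simp
    then show ?thesis
      using Svec_expectation[OF N \<omega>, of "\<lambda>s. g s (Yvec N \<omega>) (Xvec N \<omega>)"] unfolding YX by simp
  qed
  from iffD1[OF measurable_cong[OF this] fubini] show ?thesis .
qed

end

section \<open>From characteristic functions to trigonometric averages\<close>

lemma lin_comb_conv_sum:
  "lin_comb xs z = (\<Sum>j=1..length xs. fst (xs ! (j - 1)) * z (snd (xs ! (j - 1))))"
proof -
  have "lin_comb xs z = (\<Sum>j<length xs. fst (xs ! j) * z (snd (xs ! j)))"
    by (simp add: lin_comb_def sum_list_sum_nth case_prod_unfold atLeast0LessThan)
  also have "\<dots> = (\<Sum>j=1..length xs. fst (xs ! (j - 1)) * z (snd (xs ! (j - 1))))"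
    by (simp add: sum.atLeast1_atMost_eq)
  finally show ?thesis .
qed

text \<open>Cosine and sine are the real and imaginary parts of \<open>cis\<close>, and these parts
  deviate from their limits by no more than the complex averages do.\<close>

lemma (in random_weights) tendsto_mode_trig:
  assumes char: "\<And>xs. xs \<noteq> [] \<Longrightarrow> snd ` set xs \<subseteq> F \<Longrightarrow>
      tendsto_mode m M (\<lambda>N \<omega>. \<Sum>s\<in>I N. w N s \<omega> *\<^sub>R cis (lin_comb xs (\<Phi> N s \<omega>)))
        (\<integral>\<xi>. cis (lin_comb xs (path \<xi>)) \<partial>M')"
    and "g \<in> trig F"
  shows "tendsto_mode m M (\<lambda>N. avg N g) (\<integral>\<xi>. g (path \<xi>) \<partial>M')"
  using assms(2)
proof induction
  case (cos xs)
  show ?case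
  proof (cases "xs = []")
    \<comment> \<open>(CWCM) starts with one index, so the empty list, which gives a constant, is
      treated apart.\<close>
    case True
    have "tendsto_mode m M (\<lambda>N. avg N (\<lambda>z. 1)) 1"
      by (rule tendsto_mode_dominated[OF tendsto_mode_const[of m M "1::real"], where B = 1])
        (simp add: avg_const)
    then show ?thesis using True by (simp add: M'.prob_space)
  next
    case False
    have "integrable M' (\<lambda>\<xi>. cis (lin_comb xs (path \<xi>)))"
      using trig_path_measurable[OF trig.cos[OF cos]] trig_path_measurable[OF trig.sin[OF cos]]
      by (intro M'.integrable_const_bound[of _ 1]) (simp_all add: borel_measurable_complex_iff)
    then have lim: "Re (\<integral>\<xi>. cis (lin_comb xs (path \<xi>)) \<partial>M') = (\<integral>\<xi>. cos (lin_comb xs (path \<xi>)) \<partial>M')"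
      by (subst integral_Re[symmetric]) simp_all
    have fin: "Re (\<Sum>s\<in>I N. w N s \<omega> *\<^sub>R cis (lin_comb xs (\<Phi> N s \<omega>))) = avg N (\<lambda>z. cos (lin_comb xs z)) \<omega>"
      for N \<omega> by (simp add: avg_def)
    show ?thesis
      by (rule tendsto_mode_dominated[OF char[OF False cos], where B = 1])
        (simp only: lim[symmetric] fin[symmetric] dist_real_def dist_norm mult_1
          minus_complex.simps[symmetric] abs_Re_le_cmod)
  qed
next
  case (sin xs)
  show ?case
  proof (cases "xs = []")
    case True
    have "tendsto_mode m M (\<lambda>N. avg N (\<lambda>z. 0)) 0"
      by (rule tendsto_mode_dominated[OF tendsto_mode_const[of m M "0::real"], where B = 1])
        (simp add: avg_const)
    then show ?thesis using True by simp
  next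
    case False
    have "integrable M' (\<lambda>\<xi>. cis (lin_comb xs (path \<xi>)))"
      using trig_path_measurable[OF trig.cos[OF sin]] trig_path_measurable[OF trig.sin[OF sin]]
      by (intro M'.integrable_const_bound[of _ 1]) (simp_all add: borel_measurable_complex_iff)
    then have lim: "Im (\<integral>\<xi>. cis (lin_comb xs (path \<xi>)) \<partial>M') = (\<integral>\<xi>. sin (lin_comb xs (path \<xi>)) \<partial>M')"
      by (subst integral_Im[symmetric]) simp_all
    have fin: "Im (\<Sum>s\<in>I N. w N s \<omega> *\<^sub>R cis (lin_comb xs (\<Phi> N s \<omega>))) = avg N (\<lambda>z. sin (lin_comb xs z)) \<omega>"
      for N \<omega> by (simp add: avg_def)
    show ?thesis
      by (rule tendsto_mode_dominated[OF char[OF False sin], where B = 1])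
        (simp only: lim[symmetric] fin[symmetric] dist_real_def dist_norm mult_1
          minus_complex.simps[symmetric] abs_Im_le_cmod)
  qed
next
  case (add g h)
  show ?case
    using tendsto_mode_add[OF add.IH] trig_path_integrable[OF add.hyps(1)] trig_path_integrable[OF add.hyps(2)]
    by (simp add: avg_add[abs_def])
next
  case (scale g c)
  show ?case
    by (rule tendsto_mode_dominated[OF scale.IH, where B = "\<bar>c\<bar>"])
      (simp add: avg_scale dist_real_def abs_mult[symmetric] right_diff_distrib)
qed

theorem theorem4:
  fixes MY :: "'y measure" and MX :: "'x measure"
    and Pyx :: "('y \<times> 'x) measure" and Pd :: "'d measure" and D :: "'d \<Rightarrow> real"
    and M :: "((nat \<Rightarrow> 'y \<times> 'x) \<times> 'd) measure"
    and p :: "nat \<Rightarrow> (nat \<Rightarrow> nat) \<Rightarrow> (nat \<Rightarrow> 'x) \<Rightarrow> real"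
    and e :: "nat \<Rightarrow> nat \<Rightarrow> nat \<Rightarrow> nat"
    and F :: "'f set"
    and HN :: "nat \<Rightarrow> (nat \<Rightarrow> 'y \<times> 'x) \<times> 'd \<Rightarrow> 'f \<Rightarrow> real"
    and \<phi> :: "nat \<Rightarrow> (nat \<Rightarrow> nat) \<Rightarrow> (nat \<Rightarrow> 'y) \<Rightarrow> (nat \<Rightarrow> 'x) \<Rightarrow> 'f \<Rightarrow> real"
    and M' :: "'c measure" and H' :: "'f \<Rightarrow> 'c \<Rightarrow> real"
    and m :: conv_mode
  assumes "prob_space Pyx" and "sets Pyx = sets (MY \<Otimes>\<^sub>M MX)"
    and "prob_space Pd" and "D \<in> borel_measurable Pd"
    and "distr Pd borel D = uniform_measure lborel {0..1}"
    and "M = sample_space Pyx Pd"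
    and "sampling_design MX p"
    and "\<And>N. N \<ge> 1 \<Longrightarrow> bij_betw (e N) {1..2 ^ N} (bin_vecs N)"
    and "\<And>N \<omega>. N \<ge> 1 \<Longrightarrow> \<omega> \<in> space M \<Longrightarrow> HN N \<omega> \<in> mspace (linf F)"
    and "\<And>N \<omega>. N \<ge> 1 \<Longrightarrow> \<omega> \<in> space M \<Longrightarrow>
           HN N \<omega> = \<phi> N (Svec p e D N \<omega>) (Yvec N \<omega>) (Xvec N \<omega>)"
    and "\<And>N f. N \<ge> 1 \<Longrightarrow> f \<in> F \<Longrightarrow> (\<lambda>\<omega>. HN N \<omega> f) \<in> borel_measurable M"
    and "CAT m M p F \<phi>"
    and "stochastic_process M' F H'"
    and "CWCM m M p F \<phi> M' H'"
  shows "\<exists>(Q :: ('f \<Rightarrow> real) measure) (G :: ('f \<Rightarrow> real) \<Rightarrow> 'f \<Rightarrow> real).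
           prob_space Q \<and> G \<in> Q \<rightarrow>\<^sub>M borel_linf F \<and> tight_map F Q G \<and>
           same_fdd F Q (\<lambda>f \<omega>. G \<omega> f) M' H' \<and>
           tendsto_outer_mode m M
             (\<lambda>N \<omega>. SUP h\<in>BL1 F. \<bar>E_d p N (\<lambda>s y x. h (\<phi> N s y x)) \<omega> - (\<integral>\<xi>. h (G \<xi>) \<partial>Q)\<bar>) 0"
proof -
  interpret S: sampling MY MX Pyx Pd D p e
    by (rule sampling.intro) (rule assms(1-5,7,8); assumption?)+
  have M: "M = S.M" by (rule assms(6))
  define w where "w = (\<lambda>N s (\<omega> :: (nat \<Rightarrow> 'y \<times> 'x) \<times> 'd). p N s (Xvec N \<omega>))"
  define \<Phi> where "\<Phi> = (\<lambda>N s (\<omega> :: (nat \<Rightarrow> 'y \<times> 'x) \<times> 'd). \<phi> N s (Yvec N \<omega>) (Xvec N \<omega>))"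
  have "prob_space M" unfolding M by (rule S.prob_space_M)
  have M': "prob_space M'" "\<And>f. f \<in> F \<Longrightarrow> H' f \<in> borel_measurable M'"
    using assms(13) unfolding stochastic_process_def by blast+
  \<comment> \<open>Altering only the randomisation coordinate of \<omega> keeps the data and can
    make any vector of positive probability the selected one; the process is bounded at the altered
    point.\<close>
  have supp: "\<Phi> N s \<omega> \<in> mspace (linf F)"
    if N: "N \<ge> 1" "\<omega> \<in> space M" and s: "s \<in> bin_vecs N" "w N s \<omega> \<noteq> 0" for N s \<omega>
  proof -
    obtain d where d: "d \<in> space Pd" "Svec p e D N (fst \<omega>, d) = s"
      using S.Svec_attained[OF N(1) N(2)[unfolded M] s(1)] s(2) unfolding w_def by blast
    have \<omega>': "(fst \<omega>, d) \<in> space M"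
      using N(2) d(1) unfolding M S.space_M by simp
    have "HN N (fst \<omega>, d) = \<Phi> N s \<omega>"
      unfolding assms(10)[OF N(1) \<omega>'] d(2) \<Phi>_def by (simp add: Xvec_def Yvec_def)
    then show ?thesis using assms(9)[OF N(1) \<omega>'] by simp
  qed
  interpret R: random_weights M M' F H' m bin_vecs w \<Phi>
  proof (rule random_weights.intro[OF \<open>prob_space M\<close> M'(1) random_weights_axioms.intro])
    show "0 \<le> w N s \<omega>" if "N \<ge> 1" "\<omega> \<in> space M" "s \<in> bin_vecs N" for N \<omega> s
      using S.design_nonneg that unfolding w_def M by blast
    show "(\<Sum>s\<in>bin_vecs N. w N s \<omega>) = 1" if "N \<ge> 1" "\<omega> \<in> space M" for N \<omega>
      using S.design_sum that unfolding w_def M by blast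
  qed (fact supp, fact M'(2))
  have E_d_avg: "E_d p N (\<lambda>s y x. h (\<phi> N s y x)) = R.avg N h" for N and h :: "('f \<Rightarrow> real) \<Rightarrow> real"
    by (rule ext) (simp only: E_d_def R.avg_def, simp only: w_def \<Phi>_def real_scaleR_def)
  interpret C: conditionally_convergent M M' F H' m bin_vecs w \<Phi>
  proof
    fix N :: nat and g assume N: "N \<ge> 1" and g: "g \<in> trig F"
    \<comment> \<open>Coordinatewise measurability of \<open>HN N\<close> is enough for
      \<open>g\<close>; integrating out the randomisation then yields a measurable design
      expectation.\<close>
    have "(\<lambda>\<omega>. g (HN N \<omega>)) \<in> borel_measurable M"
      by (rule trig_measurable[OF assms(11)[OF N] g])
    then have "(\<lambda>\<omega>. g (\<phi> N (Svec p e D N \<omega>) (Yvec N \<omega>) (Xvec N \<omega>))) \<in> borel_measurable M"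
      using measurable_cong[of M "\<lambda>\<omega>. g (HN N \<omega>)"] assms(10)[OF N] by simp
    from S.design_expectation_measurable[OF N this[unfolded M]]
    show "R.avg N g \<in> borel_measurable M"
      unfolding M R.avg_def[abs_def] unfolding w_def \<Phi>_def .
  next
    fix g assume "g \<in> trig F"
    then show "tendsto_mode m M (\<lambda>N. R.avg N g) (\<integral>\<xi>. g (\<lambda>f. H' f \<xi>) \<partial>M')"
    proof (rule R.tendsto_mode_trig[rotated])
      fix xs :: "(real \<times> 'f) list" assume xs: "xs \<noteq> []" "snd ` set xs \<subseteq> F"
      have r: "length xs \<ge> 1" using xs(1) by (cases xs) auto
      \<comment> \<open>List positions start at 0, the indices in (CWCM) at 1.\<close>
      have "snd (xs ! (j - 1)) \<in> F" if "j \<in> {1..length xs}" for j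
        using xs(2) that nth_mem[of "j - 1" xs] by fastforce
      then have "tendsto_mode m M
          (\<lambda>N. E_d p N (\<lambda>s y x. exp (\<i> * complex_of_real (\<Sum>j=1..length xs. fst (xs ! (j - 1)) * \<phi> N s y x (snd (xs ! (j - 1)))))))
          (\<integral>\<xi>. exp (\<i> * complex_of_real (\<Sum>j=1..length xs. fst (xs ! (j - 1)) * H' (snd (xs ! (j - 1))) \<xi>)) \<partial>M')"
        using assms(14)[unfolded CWCM_def, rule_format, OF r,
            of "\<lambda>j. snd (xs ! (j - 1))" "\<lambda>j. fst (xs ! (j - 1))"] by blast
      then show "tendsto_mode m M (\<lambda>N \<omega>. \<Sum>s\<in>bin_vecs N. w N s \<omega> *\<^sub>R cis (lin_comb xs (\<Phi> N s \<omega>)))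
          (\<integral>\<xi>. cis (lin_comb xs (\<lambda>f. H' f \<xi>)) \<partial>M')"
        unfolding cis_conv_exp lin_comb_conv_sum E_d_def[abs_def] w_def \<Phi>_def .
    qed
  next
    fix \<eta> :: real assume "\<eta> > 0"
    from assms(12)[unfolded CAT_def P_d_def, rule_format, OF this]
    show "\<exists>K. compactin (mtopology_of (linf F)) K \<and> R.asymptotically_tight_in K \<eta>"
      unfolding R.asymptotically_tight_in_def E_d_avg[symmetric] .
  qed
  show ?thesis
    unfolding E_d_avg by (rule C.uniform_convergence)
qed

end
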